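(* The decision problem MatrixHasDerectSeq is in $\mathrm{NP}$.
   Context: Let $D$ be a finite index set with powerset $\mathcal{P}(D)$ and $M\in\{0,1,*\}^{D\times D}$ a symmetric matrix. For $X,Y\in\mathcal{P}(D)$ let $H^M_{X,Y}=\{(i,j)\in X\times Y\mid M_{i,j}=*\}$. A relation $R\subseteq D\times D'$ is rectangular if for all $i,j\in D$ and $i',j'\in D'$, $(i,i'),(i,j'),(j,i')\in R$ implies $(j,j')\in R$. A matrix over $\{0,1,*\}$ is pure if it has no $0$s or has no $1$s. A set $\mathcal{L}'\subseteq\mathcal{P}(D)$ is $M$-purifying if, for all $X,Y\in\mathcal{L}'$, the submatrix $M|_{X\times Y}$ is pure. A $\mathcal{P}(D)$-$M$-derectangularising sequence of length $k$ ($k\geq 2$) is a sequence $D_1,\dots,D_k$ of subsets of $D$ such that $\{D_1,\dots,D_k\}$ is $M$-purifying and the relation $H^M_{D_1,D_2}\circ H^M_{D_2,D_3}\circ\dots\circ H^M_{D_{k-1},D_k}$ is not rectangular. Here $R\circ S=\{(a,c)\mid (a,b)\in R\text{ and }(b,c)\in S\text{ for some }b\}$. Problem MatrixHasDerectSeq. Input: a finite index set $D$ and a symmetric matrix $M\in\{0,1,*\}^{D\times D}$ (represented as an array). Output: "Yes" if there is a $\mathcal{P}(D)$-$M$-derectangularising sequence (of any length); "no" otherwise. *)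

theory Defs
  imports "HOL-Computational_Algebra.Polynomial"
begin

section \<open>Multi-tape Turing machines and the class NP\<close>

datatype move = Left | Stay | Right

text \<open>
  States and tape symbols are initial segments of the natural numbers, and symbol 0 is the blank.
  The transition function maps the current state and the list of scanned symbols (one per tape)
  to the next state and, for each tape, the symbol to write and the head movement.
\<close>

record tm =
  tapes :: nat
  symbols :: nat
  states :: nat
  start :: nat
  accept :: nat
  reject :: nat
  delta :: "nat \<Rightarrow> nat list \<Rightarrow> nat \<times> (nat \<times> move) list"

text \<open>
  Symbols 1, 2, 3 are used for the input, see below. Well-formedness makes the machine finite:
  only the finitely many arguments of \<open>delta\<close> mentioned here ever occur in a computation.
\<close>

definition wf_tm :: "tm \<Rightarrow> bool" where
  "wf_tm T \<longleftrightarrow>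
     tapes T \<ge> 1 \<and> symbols T \<ge> 4 \<and>
     start T < states T \<and> accept T < states T \<and> reject T < states T \<and> accept T \<noteq> reject T \<and>
     (\<forall>q < states T. \<forall>rs. length rs = tapes T \<and> set rs \<subseteq> {..<symbols T} \<longrightarrow>
        (case delta T q rs of (q', as) \<Rightarrow>
           q' < states T \<and> length as = tapes T \<and> fst ` set as \<subseteq> {..<symbols T}))"

text \<open>A tape is two-way infinite and comes with the position of its head.\<close>

type_synonym tape = "(int \<Rightarrow> nat) \<times> int"
type_synonym config = "nat \<times> tape list"

fun scan :: "tape \<Rightarrow> nat" where
  "scan (c, h) = c h"

fun shift :: "move \<Rightarrow> int \<Rightarrow> int" where
  "shift Left h = h - 1"
| "shift Stay h = h"
| "shift Right h = h + 1"

fun act :: "nat \<times> move \<Rightarrow> tape \<Rightarrow> tape" where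
  "act (s, m) (c, h) = (c(h := s), shift m h)"

fun step :: "tm \<Rightarrow> config \<Rightarrow> config" where
  "step T (q, ts) =
     (if q = accept T \<or> q = reject T then (q, ts)
      else (case delta T q (map scan ts) of (q', as) \<Rightarrow> (q', map2 act as ts)))"

definition blank_tape :: tape where
  "blank_tape = ((\<lambda>_. 0), 0)"

definition input_tape :: "nat list \<Rightarrow> tape" where
  "input_tape w = ((\<lambda>i. if 0 \<le> i \<and> i < int (length w) then w ! nat i else 0), 0)"

definition init :: "tm \<Rightarrow> nat list \<Rightarrow> config" where
  "init T w = (start T, input_tape w # replicate (tapes T - 1) blank_tape)"

definition state_after :: "tm \<Rightarrow> nat list \<Rightarrow> nat \<Rightarrow> nat" where
  "state_after T w t = fst ((step T ^^ t) (init T w))"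

definition halts_within :: "tm \<Rightarrow> nat list \<Rightarrow> nat \<Rightarrow> bool" where
  "halts_within T w t \<longleftrightarrow> state_after T w t \<in> {accept T, reject T}"

definition accepts :: "tm \<Rightarrow> nat list \<Rightarrow> bool" where
  "accepts T w \<longleftrightarrow> (\<exists>t. state_after T w t = accept T)"

text \<open>
  Bits are written as symbols 1 and 2; symbol 3 separates an instance from a certificate.
\<close>

definition bit_symbol :: "bool \<Rightarrow> nat" where
  "bit_symbol b = (if b then 2 else 1)"

definition pair :: "bool list \<Rightarrow> bool list \<Rightarrow> nat list" where
  "pair x u = map bit_symbol x @ [3] @ map bit_symbol u"

text \<open>
  NP is defined by polynomial-time verifiers: \<open>T\<close> runs in polynomial time on every pair, and the
  members of the language are exactly the words with an accepted certificate of polynomial length.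
\<close>

definition NP :: "bool list set set" where
  "NP = {L. \<exists>T p q. wf_tm T \<and>
      (\<forall>x u. halts_within T (pair x u) (poly q (length (pair x u)))) \<and>
      (\<forall>x. x \<in> L \<longleftrightarrow> (\<exists>u. length u \<le> poly p (length x) \<and> accepts T (pair x u)))}"


section \<open>Derectangularising sequences\<close>

datatype entry = Zero | One | Star

type_synonym 'a matrix = "'a \<Rightarrow> 'a \<Rightarrow> entry"

definition symmetric_on :: "'a set \<Rightarrow> 'a matrix \<Rightarrow> bool" where
  "symmetric_on D M \<longleftrightarrow> (\<forall>i\<in>D. \<forall>j\<in>D. M i j = M j i)"

definition star_rel :: "'a matrix \<Rightarrow> 'a set \<Rightarrow> 'a set \<Rightarrow> ('a \<times> 'a) set" where
  "star_rel M X Y = {(i, j) \<in> X \<times> Y. M i j = Star}"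

definition rectangular :: "('a \<times> 'b) set \<Rightarrow> bool" where
  "rectangular R \<longleftrightarrow>
     (\<forall>i j i' j'. (i, i') \<in> R \<and> (i, j') \<in> R \<and> (j, i') \<in> R \<longrightarrow> (j, j') \<in> R)"

definition pure_on :: "'a matrix \<Rightarrow> 'a set \<Rightarrow> 'a set \<Rightarrow> bool" where
  "pure_on M X Y \<longleftrightarrow>
     (\<forall>i\<in>X. \<forall>j\<in>Y. M i j \<noteq> Zero) \<or> (\<forall>i\<in>X. \<forall>j\<in>Y. M i j \<noteq> One)"

definition purifying :: "'a matrix \<Rightarrow> 'a set set \<Rightarrow> bool" where
  "purifying M \<L> \<longleftrightarrow> (\<forall>X\<in>\<L>. \<forall>Y\<in>\<L>. pure_on M X Y)"

text \<open>
  The composition of the relations \<^term>\<open>star_rel M X Y\<close> over consecutive members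
  \<open>X\<close>, \<open>Y\<close> of the sequence.
\<close>

definition seq_rel :: "'a matrix \<Rightarrow> 'a set list \<Rightarrow> ('a \<times> 'a) set" where
  "seq_rel M Ds = foldr (O) (map2 (star_rel M) Ds (tl Ds)) Id"

definition derect_seq :: "'a set \<Rightarrow> 'a matrix \<Rightarrow> 'a set list \<Rightarrow> bool" where
  "derect_seq D M Ds \<longleftrightarrow>
     length Ds \<ge> 2 \<and> set Ds \<subseteq> Pow D \<and> purifying M (set Ds) \<and> \<not> rectangular (seq_rel M Ds)"


section \<open>The decision problem\<close>

text \<open>
  The index set is \<open>{..<n}\<close>. The array is written row by row with two bits per entry, and each row
  is ended by the remaining two-bit code. Words that do not encode a symmetric matrix are not in
  the language.
\<close>

fun entry_code :: "entry \<Rightarrow> bool list" where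
  "entry_code Zero = [False, False]"
| "entry_code One = [False, True]"
| "entry_code Star = [True, False]"

definition row_code :: "nat \<Rightarrow> (nat \<Rightarrow> entry) \<Rightarrow> bool list" where
  "row_code n r = concat (map (\<lambda>j. entry_code (r j)) [0..<n]) @ [True, True]"

definition matrix_code :: "nat \<Rightarrow> nat matrix \<Rightarrow> bool list" where
  "matrix_code n M = concat (map (\<lambda>i. row_code n (M i)) [0..<n])"

definition MatrixHasDerectSeq :: "bool list set" where
  "MatrixHasDerectSeq =
     {matrix_code n M | n M. symmetric_on {..<n} M \<and> (\<exists>Ds. derect_seq {..<n} M Ds)}"

lemma concat_map_inject:
  assumes "concat (map f xs) = concat (map g xs)" "\<And>x. x \<in> set xs \<Longrightarrow> length (f x) = length (g x)"
  shows "\<forall>x\<in>set xs. f x = g x"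
  using assms by (induction xs) auto

lemma length_entry_code [simp]: "length (entry_code e) = 2"
  by (cases e) auto

lemma entry_code_inject [simp]: "entry_code e = entry_code e' \<longleftrightarrow> e = e'"
  by (cases e; cases e') auto

lemma length_row_code [simp]: "length (row_code n r) = 2 * n + 2"
  by (simp add: row_code_def length_concat comp_def sum_list_triv)

lemma length_matrix_code: "length (matrix_code n M) = n * (2 * n + 2)"
  by (simp add: matrix_code_def length_concat comp_def sum_list_triv)

lemma matrix_code_inject:
  assumes "matrix_code n M = matrix_code n' M'"
  shows "n = n' \<and> (\<forall>i<n. \<forall>j<n. M i j = M' i j)"
proof -
  have "n * (2 * n + 2) = n' * (2 * n' + 2)"
    using assms by (metis length_matrix_code)
  moreover have "a * (2 * a + 2) < b * (2 * b + 2)" if "a < b" for a b :: nat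
    using that by (intro mult_strict_mono) auto
  ultimately have n: "n = n'"
    by (metis less_irrefl linorder_neqE_nat)
  have "M i j = M' i j" if "i < n" "j < n" for i j
  proof -
    have "\<forall>i\<in>set [0..<n]. row_code n (M i) = row_code n (M' i)"
      using assms n unfolding matrix_code_def by (intro concat_map_inject) auto
    then have "concat (map (\<lambda>j. entry_code (M i j)) [0..<n]) =
        concat (map (\<lambda>j. entry_code (M' i j)) [0..<n])"
      using that by (simp add: row_code_def)
    then have "\<forall>j\<in>set [0..<n]. entry_code (M i j) = entry_code (M' i j)"
      by (intro concat_map_inject) auto
    then show ?thesis
      using that by simp
  qed
  then show ?thesis
    using n by blast
qed

end

theory Submission
  imports Defs
begin

text \<open>
  Non-rectangularity of the composed relation is witnessed by three paths, and the sets of the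
  sequence may be shrunk to the at most three elements on these paths. Keeping only each set and the
  parts of it reachable from the two starting points, one gets a walk among polynomially many
  states, so a shortest sequence has polynomial length and can serve as the certificate.

  To check it by a Turing machine, the verification is written as a bounded first-order formula over
  polynomial terms and the symbols of the input. Heads on read-only copies of the input serve as
  counters, which suffices to evaluate terms and to run through the quantifiers in polynomial time.
\<close>

section \<open>Programs for multi-head machines\<close>

text \<open>Purity relates every pair of sets in the sequence, so no single state of a walk could
  record it. It survives both reductions because subsets of pure pairs are pure and a shortened walk
  visits only sets already present. A missing fourth corner is a statement about all paths; tracking
  the exact images of the two starting points turns it into a condition on the last state.

  A finite relation joins two points of a nontrivial walk by one with at most as many steps as it
  has pairs. Here a pair consists of two triples of sets, each with at most three elements, whence
  the bound \<open>(n ^ 3 + 1) ^ 6\<close>.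

  The verifier has to stop in time on malformed words too. For bounded formulas this follows from
  their shape: a quantifier is one sweep over the input, and a term has polynomial value. The price
  is that quantified numbers, among them the index of the last set, cannot exceed the input length;
  the certificate makes the input long enough, since it spends at least one bit on every
  set.\<close>

text \<open>
  Programs return a truth value: a conditional branches on the value of its first component, and a
  loop repeats its body until it returns \<open>False\<close>. The input is first copied to every tape, so that
  the tapes are never written on again and act as heads on one common input.
\<close>

datatype prog =
    Done bool
  | Test nat nat
  | Move nat move
  | Cond prog prog prog
  | Loop prog

datatype frame = Branch prog prog | Again prog

text \<open>\<open>Run c s\<close> is about to execute \<open>c\<close>, \<open>Ret b s\<close> has
  just obtained the value \<open>b\<close>; the frames in \<open>s\<close> are the pending
  continuations, innermost first.\<close>

datatype ctl = Left_End | Mark | Copy | Rewind | Run prog "frame list" | Ret bool "frame list"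

abbreviation stay :: "nat list \<Rightarrow> (nat \<times> move) list" where
  "stay rs \<equiv> map (\<lambda>r. (r, Stay)) rs"

fun next_ctl :: "prog \<Rightarrow> ctl \<Rightarrow> nat list \<Rightarrow> ctl \<times> (nat \<times> move) list" where
  "next_ctl p Left_End rs = (Mark, map (\<lambda>r. (r, Left)) rs)"
| "next_ctl p Mark rs = (Copy, map (\<lambda>r. (4, Right)) rs)"
| "next_ctl p Copy rs =
    (if hd rs = 0 then (Rewind, map (\<lambda>r. (r, Left)) rs)
     else (Copy, map (\<lambda>r. (hd rs, Right)) rs))"
| "next_ctl p Rewind rs =
    (if hd rs = 4 then (Run p [], stay rs) else (Rewind, map (\<lambda>r. (r, Left)) rs))"
| "next_ctl p (Run (Done b) s) rs = (Ret b s, stay rs)"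
| "next_ctl p (Run (Test i a) s) rs = (Ret (rs ! i = a) s, stay rs)"
| "next_ctl p (Run (Move i m) s) rs = (Ret True s, (stay rs)[i := (rs ! i, m)])"
| "next_ctl p (Run (Cond a b c) s) rs = (Run a (Branch b c # s), stay rs)"
| "next_ctl p (Run (Loop c) s) rs = (Run c (Again c # s), stay rs)"
| "next_ctl p (Ret r []) rs = (Ret r [], stay rs)"
| "next_ctl p (Ret r (Branch b c # s)) rs = (Run (if r then b else c) s, stay rs)"
| "next_ctl p (Ret r (Again c # s)) rs =
    (if r then Run c (Again c # s) else Ret True s, stay rs)"

fun astep :: "prog \<Rightarrow> ctl \<times> tape list \<Rightarrow> ctl \<times> tape list" where
  "astep p (q, ts) = (case next_ctl p q (map scan ts) of (q', as) \<Rightarrow> (q', map2 act as ts))"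

section \<open>Finiteness of the control\<close>

fun ctls :: "prog \<Rightarrow> frame list \<Rightarrow> ctl set" where
  "ctls (Done b) s = {Run (Done b) s, Ret True s, Ret False s}"
| "ctls (Test i a) s = {Run (Test i a) s, Ret True s, Ret False s}"
| "ctls (Move i m) s = {Run (Move i m) s, Ret True s, Ret False s}"
| "ctls (Cond a b c) s =
    insert (Run (Cond a b c) s) (ctls a (Branch b c # s) \<union> ctls b s \<union> ctls c s)"
| "ctls (Loop c) s = {Run (Loop c) s, Ret True s, Ret False s} \<union> ctls c (Again c # s)"

text \<open>Stacks are lists, so finiteness is not a matter of types. During a run the stack mirrors
  a position in the syntax tree, since a new round of a loop reuses the frame of that loop.\<close>

lemma finite_ctls: "finite (ctls c s)"
  by (induction c arbitrary: s) auto

lemma Run_in_ctls: "Run c s \<in> ctls c s"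
  by (cases c) auto

lemma Ret_in_ctls: "Ret b s \<in> ctls c s"
  by (induction c arbitrary: s; cases b) auto

text \<open>A return to \<open>s\<close> itself leaves \<open>c\<close> and is therefore excluded; a
  return to a frame pushed by \<open>c\<close> enters a component of \<open>c\<close> or leads to a
  return from \<open>c\<close>.\<close>

lemma next_ctl_in_ctls:
  assumes "q \<in> ctls c s" "\<And>b. q \<noteq> Ret b s"
  shows "fst (next_ctl p q rs) \<in> ctls c s"
  using assms
proof (induction c arbitrary: s)
  case (Cond a b c)
  show ?case
  proof (cases "\<exists>r. q = Ret r (Branch b c # s)")
    case True
    then show ?thesis by (auto simp: Run_in_ctls)
  next
    case False
    then show ?thesis
      using Cond by (auto simp: Run_in_ctls)
  qed
next
  case (Loop c)
  show ?case
  proof (cases "\<exists>r. q = Ret r (Again c # s)")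
    case True
    then obtain r where "q = Ret r (Again c # s)" by blast
    then show ?thesis by (cases r) (auto simp: Run_in_ctls)
  next
    case False
    then show ?thesis
      using Loop by (auto simp: Run_in_ctls)
  qed
qed auto

definition all_ctls :: "prog \<Rightarrow> ctl set" where
  "all_ctls p = {Left_End, Mark, Copy, Rewind} \<union> ctls p []"

lemma next_ctl_in_all_ctls:
  assumes "q \<in> all_ctls p"
  shows "fst (next_ctl p q rs) \<in> all_ctls p"
proof (cases "q \<in> ctls p [] \<and> (\<forall>b. q \<noteq> Ret b [])")
  case True
  then show ?thesis
    using next_ctl_in_ctls[of q p "[]"] by (auto simp: all_ctls_def)
next
  case False
  then show ?thesis
    using assms Ret_in_ctls Run_in_ctls by (auto simp: all_ctls_def split: if_splits)
qed

lemma snd_next_ctl: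
  assumes "set rs \<subseteq> {..<5}" "rs \<noteq> []"
  shows "length (snd (next_ctl p q rs)) = length rs" "fst ` set (snd (next_ctl p q rs)) \<subseteq> {..<5}"
proof -
  have hd: "hd rs < 5"
    using assms by (metis hd_in_set lessThan_iff subsetD)
  have upd: "fst ` set ((stay rs)[i := (rs ! i, m)]) \<subseteq> {..<5}" for i m
  proof (cases "i < length rs")
    case True
    then have "rs ! i < 5"
      using assms by (metis lessThan_iff nth_mem subsetD)
    then show ?thesis
      using assms(1) set_update_subset_insert[of "stay rs" i "(rs ! i, m)"] by fastforce
  next
    case False
    then show ?thesis
      using assms(1) by (auto simp: list_update_beyond)
  qed
  show "length (snd (next_ctl p q rs)) = length rs"
    by (induction p q rs rule: next_ctl.induct) auto
  show "fst ` set (snd (next_ctl p q rs)) \<subseteq> {..<5}"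
    using assms hd upd by (induction p q rs rule: next_ctl.induct) (auto split: if_splits)
qed


subsection \<open>Realisation by Turing machines\<close>

definition enum :: "prog \<Rightarrow> ctl \<Rightarrow> nat" where
  "enum p = (SOME f. bij_betw f (all_ctls p) {0..<card (all_ctls p)})"

lemma bij_enum: "bij_betw (enum p) (all_ctls p) {0..<card (all_ctls p)}"
proof -
  have "finite (all_ctls p)"
    by (simp add: all_ctls_def finite_ctls)
  then have "\<exists>f. bij_betw f (all_ctls p) {0..<card (all_ctls p)}"
    by (rule ex_bij_betw_finite_nat)
  then show ?thesis
    unfolding enum_def by (rule someI_ex)
qed

definition machine :: "nat \<Rightarrow> prog \<Rightarrow> tm" where
  "machine K p = \<lparr>tapes = K, symbols = 5, states = card (all_ctls p), start = enum p Left_End,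
     accept = enum p (Ret True []), reject = enum p (Ret False []),
     delta = (\<lambda>q rs. map_prod (enum p) id (next_ctl p (inv_into (all_ctls p) (enum p) q) rs))\<rparr>"

lemma enum_less: "q \<in> all_ctls p \<Longrightarrow> enum p q < card (all_ctls p)"
  using bij_enum[of p] by (auto simp: bij_betw_def)

lemma enum_eq_iff: "q \<in> all_ctls p \<Longrightarrow> q' \<in> all_ctls p \<Longrightarrow> enum p q = enum p q' \<longleftrightarrow> q = q'"
  using bij_enum[of p] by (auto simp: bij_betw_def inj_on_def)

lemma inv_enum: "q \<in> all_ctls p \<Longrightarrow> inv_into (all_ctls p) (enum p) (enum p q) = q"
  using bij_enum[of p] by (auto simp: bij_betw_def)

lemma Ret_in_all_ctls: "Ret b [] \<in> all_ctls p"
  using Ret_in_ctls by (auto simp: all_ctls_def)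

lemma wf_machine:
  assumes "K \<ge> 1"
  shows "wf_tm (machine K p)"
proof -
  have "case delta (machine K p) q rs of (q', as) \<Rightarrow>
      q' < states (machine K p) \<and> length as = tapes (machine K p) \<and>
      fst ` set as \<subseteq> {..<symbols (machine K p)}"
    if q: "q < states (machine K p)"
      and rs: "length rs = tapes (machine K p)" "set rs \<subseteq> {..<symbols (machine K p)}" for q rs
  proof -
    have "inv_into (all_ctls p) (enum p) q \<in> all_ctls p"
      using q bij_enum[of p] by (intro inv_into_into) (auto simp: bij_betw_def machine_def)
    then have "enum p (fst (next_ctl p (inv_into (all_ctls p) (enum p) q) rs)) < card (all_ctls p)"
      by (intro enum_less next_ctl_in_all_ctls)
    moreover have "rs \<noteq> []"
      using rs assms by (auto simp: machine_def)
    ultimately show ?thesis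
      using rs snd_next_ctl[of rs p "inv_into (all_ctls p) (enum p) q"]
      by (cases "next_ctl p (inv_into (all_ctls p) (enum p) q) rs") (simp add: machine_def)
  qed
  moreover have "Left_End \<in> all_ctls p"
    by (simp add: all_ctls_def)
  ultimately show ?thesis
    unfolding wf_tm_def
    using assms enum_less Ret_in_all_ctls enum_eq_iff[OF Ret_in_all_ctls Ret_in_all_ctls]
    by (auto simp: machine_def)
qed

lemma map2_act_stay [simp]: "map2 act (map ((\<lambda>r. (r, Stay)) \<circ> scan) ts) ts = ts"
proof (induction ts)
  case (Cons t ts)
  then show ?case by (cases t) simp
qed simp

lemma astep_Ret [simp]: "astep p (Ret b [], ts) = (Ret b [], ts)"
  by simp

text \<open>\<open>step\<close> freezes in the two halting states without consulting
  \<open>delta\<close>; \<open>astep\<close> agrees there because a return with empty stack is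
  mapped to itself.\<close>

lemma step_machine:
  assumes "q \<in> all_ctls p"
  shows "step (machine K p) (enum p q, ts) = map_prod (enum p) id (astep p (q, ts))"
proof (cases "\<exists>b. q = Ret b []")
  case True
  then obtain b where "q = Ret b []" by blast
  then show ?thesis
    by (cases b) (auto simp: machine_def simp del: astep.simps)
next
  case False
  then have "enum p q \<noteq> enum p (Ret b [])" for b
    using enum_eq_iff[OF assms Ret_in_all_ctls] by simp
  then show ?thesis
    by (auto simp: machine_def inv_enum[OF assms] split: prod.split)
qed

lemma steps_machine:
  assumes "q \<in> all_ctls p"
  shows "fst ((astep p ^^ t) (q, ts)) \<in> all_ctls p"
    and "(step (machine K p) ^^ t) (enum p q, ts) = map_prod (enum p) id ((astep p ^^ t) (q, ts))"
proof -
  have "fst ((astep p ^^ t) (q, ts)) \<in> all_ctls p \<and>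
    (step (machine K p) ^^ t) (enum p q, ts) = map_prod (enum p) id ((astep p ^^ t) (q, ts))"
  proof (induction t)
    case (Suc t)
    obtain q' ts' where eq: "(astep p ^^ t) (q, ts) = (q', ts')"
      by (cases "(astep p ^^ t) (q, ts)")
    with Suc have q': "q' \<in> all_ctls p"
      by simp
    have "fst (astep p (q', ts')) \<in> all_ctls p"
      using next_ctl_in_all_ctls[OF q', of "map scan ts'"] by (auto split: prod.split)
    then show ?case
      using Suc eq step_machine[OF q'] by (simp add: id_def del: astep.simps step.simps)
  qed (use assms in simp)
  then show "fst ((astep p ^^ t) (q, ts)) \<in> all_ctls p"
    and "(step (machine K p) ^^ t) (enum p q, ts) = map_prod (enum p) id ((astep p ^^ t) (q, ts))"
    by blast+
qed

section \<open>Reachability within a time bound\<close>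

definition reaches :: "prog \<Rightarrow> nat \<Rightarrow> ctl \<times> tape list \<Rightarrow> ctl \<times> tape list \<Rightarrow> bool" where
  "reaches p B x y \<longleftrightarrow> (\<exists>t\<le>B. (astep p ^^ t) x = y)"

lemma reaches_trans:
  assumes "reaches p B x y" "reaches p C y z"
  shows "reaches p (B + C) x z"
proof -
  obtain t u where "t \<le> B" "(astep p ^^ t) x = y" "u \<le> C" "(astep p ^^ u) y = z"
    using assms unfolding reaches_def by blast
  then show ?thesis
    unfolding reaches_def by (intro exI[of _ "u + t"]) (simp add: funpow_add)
qed

lemma reaches_refl: "reaches p B x x"
  unfolding reaches_def by (intro exI[of _ 0]) simp

lemma reaches_mono: "reaches p B x y \<Longrightarrow> B \<le> C \<Longrightarrow> reaches p C x y"
  unfolding reaches_def by (blast intro: order_trans)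

lemma reaches_step: "reaches p B (astep p x) y \<Longrightarrow> reaches p (Suc B) x y"
  unfolding reaches_def by (metis Suc_le_mono comp_apply funpow_Suc_right)

lemma machine_verdict:
  assumes "reaches p B (Left_End, input_tape w # replicate (K - 1) blank_tape) (Ret b [], ts)"
  shows "halts_within (machine K p) w B" "accepts (machine K p) w \<longleftrightarrow> b"
proof -
  let ?T = "machine K p"
  let ?s = "\<lambda>t. (astep p ^^ t) (Left_End, input_tape w # replicate (K - 1) blank_tape)"
  have start: "Left_End \<in> all_ctls p"
    by (simp add: all_ctls_def)
  have init: "init ?T w = (enum p Left_End, input_tape w # replicate (K - 1) blank_tape)"
    by (simp add: init_def machine_def)
  have state: "state_after ?T w t = enum p (fst (?s t))" for t
    unfolding state_after_def init steps_machine(2)[OF start] by simp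
  have stable: "?s t' = (Ret r [], ts')" if "?s t = (Ret r [], ts')" "t \<le> t'" for t t' r ts'
    using that(2,1) by (induction t' rule: dec_induct) (simp_all del: astep.simps)
  obtain t where t: "t \<le> B" "?s t = (Ret b [], ts)"
    using assms unfolding reaches_def by blast
  show "halts_within ?T w B"
    unfolding halts_within_def state using stable[OF t(2,1)]
    by (cases b) (auto simp: machine_def)
  show "accepts ?T w \<longleftrightarrow> b"
  proof
    assume "accepts ?T w"
    then obtain t' where "enum p (fst (?s t')) = enum p (Ret True [])"
      unfolding accepts_def state by (auto simp: machine_def)
    then have "fst (?s t') = Ret True []"
      using enum_eq_iff[OF steps_machine(1)[OF start] Ret_in_all_ctls] by blast
    then have *: "?s t' = (Ret True [], snd (?s t'))"
      by (metis prod.collapse)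
    \<comment> \<open>Both configurations persist from their halting times on, so they coincide at
      the later of the two.\<close>
    have "?s (max t t') = (Ret True [], snd (?s t'))" "?s (max t t') = (Ret b [], ts)"
      using stable[OF *, of "max t t'"] stable[OF t(2), of "max t t'"] by simp_all
    then show b
      by simp
  next
    assume b
    then show "accepts ?T w"
      unfolding accepts_def state using t(2) by (auto simp: machine_def intro!: exI[of _ t])
  qed
qed


subsection \<open>Reading the input\<close>

definition cells :: "nat list \<Rightarrow> int \<Rightarrow> nat" where
  "cells w z = (if z = -1 then 4 else if 0 \<le> z \<and> z < int (length w) then w ! nat z else 0)"

definition tapes_of :: "nat \<Rightarrow> nat list \<Rightarrow> (nat \<Rightarrow> nat) \<Rightarrow> tape list" where
  "tapes_of K w \<sigma> = map (\<lambda>i. (cells w, int (\<sigma> i) - 1)) [0..<K]"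

text \<open>All heads move in lockstep, and the blank after the word, seen on the first tape, ends
  the phase; hence no \<open>0\<close> may occur in \<open>w\<close>. The other tapes already carry
  the end marker and the prefix \<open>take k w\<close>.\<close>

lemma reaches_Copy:
  assumes "0 \<notin> set w" "k \<le> length w"
  shows "reaches p (length w - k + 1)
    (Copy, (cells w, int k) # replicate K (cells (take k w), int k))
    (Rewind, replicate (Suc K) (cells w, int (length w) - 1))"
  using assms(2)
proof (induction k rule: inc_induct)
  case base
  have "cells w (int (length w)) = 0"
    by (simp add: cells_def)
  then have "(cells w)(int (length w) := 0) = cells w"
    by (metis fun_upd_triv)
  then have "astep p (Copy, (cells w, int (length w)) # replicate K (cells w, int (length w))) =
      (Rewind, replicate (Suc K) (cells w, int (length w) - 1))"
    using \<open>cells w (int (length w)) = 0\<close> by (simp add: zip_replicate map_replicate_const)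
  then show ?case
    by (simp add: reaches_step reaches_refl)
next
  case (step k)
  have k: "cells w (int k) = w ! k"
    using step by (simp add: cells_def)
  moreover have "w ! k \<noteq> 0"
    using step assms(1) by (metis nth_mem)
  moreover have "(cells w)(int k := w ! k) = cells w"
    using k by (metis fun_upd_triv)
  moreover have "(cells (take k w))(int k := w ! k) = cells (take (Suc k) w)"
    using step by (auto simp: cells_def fun_eq_iff less_Suc_eq nth_append take_Suc_conv_app_nth)
  ultimately have "astep p (Copy, (cells w, int k) # replicate K (cells (take k w), int k)) =
      (Copy, (cells w, int (Suc k)) # replicate K (cells (take (Suc k) w), int (Suc k)))"
    by (simp add: zip_replicate map_replicate_const add.commute)
  then have "reaches p (Suc (length w - Suc k + 1))
    (Copy, (cells w, int k) # replicate K (cells (take k w), int k))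
    (Rewind, replicate (Suc K) (cells w, int (length w) - 1))"
    using step by (intro reaches_step) simp
  then show ?case
    using step by (simp add: Suc_diff_Suc)
qed

lemma reaches_Rewind:
  assumes "4 \<notin> set w" "k \<le> length w"
  shows "reaches p (Suc k) (Rewind, replicate (Suc K) (cells w, int k - 1))
    (Run p [], tapes_of (Suc K) w (\<lambda>_. 0))"
  using assms(2)
proof (induction k)
  case 0
  have "cells w (-1) = 4"
    by (simp add: cells_def)
  moreover from this have "(cells w)(-1 := 4) = cells w"
    by (metis fun_upd_triv)
  moreover have "tapes_of (Suc K) w (\<lambda>_. 0) = replicate (Suc K) (cells w, -1)"
    unfolding tapes_of_def map_replicate_const by simp
  ultimately have "astep p (Rewind, replicate (Suc K) (cells w, -1)) =
      (Run p [], tapes_of (Suc K) w (\<lambda>_. 0))"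
    by (simp add: zip_replicate map_replicate_const)
  then show ?case
    by (simp add: reaches_step reaches_refl)
next
  case (Suc k)
  have k: "cells w (int k) = w ! k"
    using Suc by (simp add: cells_def)
  moreover have "w ! k \<noteq> 4"
    using Suc assms(1) by (metis Suc_le_lessD nth_mem)
  moreover have "(cells w)(int k := w ! k) = cells w"
    using k by (metis fun_upd_triv)
  ultimately have "astep p (Rewind, replicate (Suc K) (cells w, int (Suc k) - 1)) =
      (Rewind, replicate (Suc K) (cells w, int k - 1))"
    by (simp add: zip_replicate map_replicate_const)
  then show ?case
    using Suc by (subst reaches_step) (simp_all del: astep.simps replicate.simps)
qed

text \<open>Two steps place the marker, \<open>length w + 1\<close> steps copy the word, and as many
  rewind the heads.\<close>

lemma reaches_Run:
  assumes "0 \<notin> set w" "4 \<notin> set w" "K \<ge> 1"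
  shows "reaches p (2 * length w + 4) (Left_End, input_tape w # replicate (K - 1) blank_tape)
    (Run p [], tapes_of K w (\<lambda>_. 0))"
proof -
  obtain K' where K: "K = Suc K'"
    using assms(3) by (cases K) auto
  have "(\<lambda>i. if 0 \<le> i \<and> i < int (length w) then w ! nat i else 0)(-1 := 4) = cells w"
    "(\<lambda>_. 0)(-1 := 4) = cells []"
    by (auto simp: cells_def fun_eq_iff)
  then have "astep p (astep p (Left_End, input_tape w # replicate K' blank_tape)) =
      (Copy, (cells w, int 0) # replicate K' (cells (take 0 w), int 0))"
    by (simp add: input_tape_def blank_tape_def zip_replicate map_replicate_const fun_upd_idem)
  then have "reaches p (Suc (Suc (length w - 0 + 1)))
      (Left_End, input_tape w # replicate K' blank_tape)
      (Rewind, replicate (Suc K') (cells w, int (length w) - 1))"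
    using reaches_Copy[OF assms(1), of 0] by (intro reaches_step) (simp del: astep.simps)
  from reaches_trans[OF this reaches_Rewind[OF assms(2) order_refl]]
  show ?thesis
    unfolding K diff_Suc_1 by (rule reaches_mono) auto
qed


subsection \<open>Semantics of programs\<close>

text \<open>
  The head variable \<open>i\<close> holds the value \<open>v\<close> when head \<open>i\<close> is on cell \<open>v - 1\<close>; the end marker 4
  thus serves as a test for zero, and heads may count beyond the end of the input.
\<close>

definition runs :: "nat \<Rightarrow> nat list \<Rightarrow> prog \<Rightarrow> (nat \<Rightarrow> nat) \<Rightarrow> bool \<Rightarrow> (nat \<Rightarrow> nat) \<Rightarrow> nat \<Rightarrow> bool" where
  "runs K w c \<sigma> b \<sigma>' B \<longleftrightarrow>
    (\<forall>p s. reaches p B (Run c s, tapes_of K w \<sigma>) (Ret b s, tapes_of K w \<sigma>'))"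

definition look :: "nat list \<Rightarrow> nat \<Rightarrow> nat" where
  "look w v = cells w (int v - 1)"

lemma look_eq: "look w v = (if v = 0 then 4 else if v \<le> length w then w ! (v - 1) else 0)"
  by (auto simp: look_def cells_def nat_diff_distrib)

lemma runs_mono: "runs K w c \<sigma> b \<sigma>' B \<Longrightarrow> B \<le> B' \<Longrightarrow> runs K w c \<sigma> b \<sigma>' B'"
  unfolding runs_def by (blast intro: reaches_mono)

lemma map_scan_tapes_of: "map scan (tapes_of K w \<sigma>) = map (\<lambda>i. look w (\<sigma> i)) [0..<K]"
  by (simp add: tapes_of_def look_def)

lemma astep_stay:
  assumes "next_ctl p q (map scan ts) = (q', stay (map scan ts))"
  shows "astep p (q, ts) = (q', ts)"
  using assms by simp

lemma runs_Done: "runs K w (Done b) \<sigma> b \<sigma> 1"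
proof -
  have "astep p (Run (Done b) s, ts) = (Ret b s, ts)" for p s ts
    by (rule astep_stay) simp
  then show ?thesis
    unfolding runs_def One_nat_def by (auto intro!: reaches_step simp: reaches_refl simp del: astep.simps)
qed

lemma runs_Test:
  assumes "i < K"
  shows "runs K w (Test i a) \<sigma> (look w (\<sigma> i) = a) \<sigma> 1"
proof -
  have "astep p (Run (Test i a) s, tapes_of K w \<sigma>) =
      (Ret (look w (\<sigma> i) = a) s, tapes_of K w \<sigma>)" for p s
    using assms by (intro astep_stay) (simp add: map_scan_tapes_of del: map_map)
  then show ?thesis
    unfolding runs_def One_nat_def by (auto intro!: reaches_step simp: reaches_refl simp del: astep.simps)
qed

lemma runs_Move:
  assumes "i < K" "int v - 1 = shift m (int (\<sigma> i) - 1)"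
  shows "runs K w (Move i m) \<sigma> True (\<sigma>(i := v)) 1"
proof -
  have "map2 act ((stay (map scan (tapes_of K w \<sigma>)))[i := (map scan (tapes_of K w \<sigma>) ! i, m)])
      (tapes_of K w \<sigma>) = tapes_of K w (\<sigma>(i := v))"
    using assms by (intro nth_equalityI) (auto simp: tapes_of_def nth_list_update fun_upd_idem)
  then have "astep p (Run (Move i m) s, tapes_of K w \<sigma>) = (Ret True s, tapes_of K w (\<sigma>(i := v)))"
    for p s
    by simp
  then show ?thesis
    unfolding runs_def One_nat_def by (auto intro!: reaches_step simp: reaches_refl simp del: astep.simps)
qed

lemma runs_Right: "i < K \<Longrightarrow> runs K w (Move i Right) \<sigma> True (\<sigma>(i := Suc (\<sigma> i))) 1"
  by (rule runs_Move) auto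

lemma runs_Left: "i < K \<Longrightarrow> \<sigma> i > 0 \<Longrightarrow> runs K w (Move i Left) \<sigma> True (\<sigma>(i := \<sigma> i - 1)) 1"
  by (rule runs_Move) auto

text \<open>The two extra steps push the \<open>Branch\<close> frame and pop it.\<close>

lemma runs_Cond:
  assumes "runs K w a \<sigma> r \<sigma>1 A" "runs K w (if r then b else c) \<sigma>1 r' \<sigma>2 B"
  shows "runs K w (Cond a b c) \<sigma> r' \<sigma>2 (A + B + 2)"
  unfolding runs_def
proof (intro allI)
  fix p s
  have 1: "astep p (Run (Cond a b c) s, ts) = (Run a (Branch b c # s), ts)" for ts
    by (rule astep_stay) simp
  have 2: "astep p (Ret r (Branch b c # s), ts) = (Run (if r then b else c) s, ts)" for ts
    by (rule astep_stay) simp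
  have "reaches p (Suc B) (Ret r (Branch b c # s), tapes_of K w \<sigma>1) (Ret r' s, tapes_of K w \<sigma>2)"
    using assms(2) unfolding runs_def by (intro reaches_step, unfold 2) blast
  then have "reaches p (Suc (A + Suc B)) (Run (Cond a b c) s, tapes_of K w \<sigma>)
      (Ret r' s, tapes_of K w \<sigma>2)"
    using assms(1) unfolding runs_def by (intro reaches_step, unfold 1) (blast intro: reaches_trans)
  then show "reaches p (A + B + 2) (Run (Cond a b c) s, tapes_of K w \<sigma>)
      (Ret r' s, tapes_of K w \<sigma>2)"
    by simp
qed

abbreviation Seq :: "prog \<Rightarrow> prog \<Rightarrow> prog" where
  "Seq a b \<equiv> Cond a b b"

lemma runs_Seq:
  assumes "runs K w a \<sigma> r \<sigma>1 A" "runs K w b \<sigma>1 r' \<sigma>2 B"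
  shows "runs K w (Seq a b) \<sigma> r' \<sigma>2 (A + B + 2)"
  using runs_Cond[OF assms(1), of b b] assms(2) by simp

text \<open>\<open>S k\<close> is the head assignment after \<open>k\<close> rounds; the failing
  round may change it once more, to \<open>\<sigma>\<close>. One step enters the loop, and each of
  the \<open>n + 1\<close> bodies is followed by one step at its frame.\<close>

lemma runs_Loop:
  assumes "\<And>k. k < n \<Longrightarrow> runs K w c (S k) True (S (Suc k)) B" "runs K w c (S n) False \<sigma> B"
  shows "runs K w (Loop c) (S 0) True \<sigma> (Suc (Suc n * Suc B))"
  unfolding runs_def
proof (intro allI)
  fix p s
  have 1: "astep p (Run (Loop c) s, ts) = (Run c (Again c # s), ts)" for ts
    by (rule astep_stay) simp
  have 2: "astep p (Ret True (Again c # s), ts) = (Run c (Again c # s), ts)" for ts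
    by (rule astep_stay) simp
  have 3: "astep p (Ret False (Again c # s), ts) = (Ret True s, ts)" for ts
    by (rule astep_stay) simp
  have "reaches p (Suc (n - k) * Suc B) (Run c (Again c # s), tapes_of K w (S k))
      (Ret True s, tapes_of K w \<sigma>)" if "k \<le> n" for k
    using that
  proof (induction k rule: inc_induct)
    case base
    have "reaches p (B + Suc 0) (Run c (Again c # s), tapes_of K w (S n))
        (Ret True s, tapes_of K w \<sigma>)"
    proof (rule reaches_trans)
      show "reaches p B (Run c (Again c # s), tapes_of K w (S n))
          (Ret False (Again c # s), tapes_of K w \<sigma>)"
        using assms(2) unfolding runs_def by blast
      show "reaches p (Suc 0) (Ret False (Again c # s), tapes_of K w \<sigma>) (Ret True s, tapes_of K w \<sigma>)"
        by (rule reaches_step, unfold 3, rule reaches_refl)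
    qed
    then show ?case
      by simp
  next
    case (step k)
    have "reaches p (B + Suc (Suc (n - Suc k) * Suc B)) (Run c (Again c # s), tapes_of K w (S k))
        (Ret True s, tapes_of K w \<sigma>)"
    proof (rule reaches_trans)
      show "reaches p B (Run c (Again c # s), tapes_of K w (S k))
          (Ret True (Again c # s), tapes_of K w (S (Suc k)))"
        using assms(1)[of k] step unfolding runs_def by blast
      show "reaches p (Suc (Suc (n - Suc k) * Suc B))
          (Ret True (Again c # s), tapes_of K w (S (Suc k))) (Ret True s, tapes_of K w \<sigma>)"
        by (rule reaches_step, unfold 2, rule step.IH)
    qed
    moreover have "B + Suc (Suc (n - Suc k) * Suc B) = Suc (n - k) * Suc B"
      using step by (simp flip: Suc_diff_Suc)
    ultimately show ?case
      by (simp only:)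
  qed
  from this[of 0] show "reaches p (Suc (Suc n * Suc B)) (Run (Loop c) s, tapes_of K w (S 0))
      (Ret True s, tapes_of K w \<sigma>)"
    by (intro reaches_step, unfold 1) simp
qed

fun width :: "prog \<Rightarrow> nat" where
  "width (Done b) = 0"
| "width (Test i a) = Suc i"
| "width (Move i m) = Suc i"
| "width (Cond a b c) = max (width a) (max (width b) (width c))"
| "width (Loop c) = width c"


section \<open>Bounded arithmetic formulas\<close>

datatype trm = Var nat | Num nat | Plus trm trm | Times trm trm

primrec val :: "(nat \<Rightarrow> nat) \<Rightarrow> trm \<Rightarrow> nat" where
  "val \<sigma> (Var i) = \<sigma> i"
| "val \<sigma> (Num k) = k"
| "val \<sigma> (Plus t u) = val \<sigma> t + val \<sigma> u"
| "val \<sigma> (Times t u) = val \<sigma> t * val \<sigma> u"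

primrec wf_trm :: "nat \<Rightarrow> trm \<Rightarrow> bool" where
  "wf_trm d (Var i) \<longleftrightarrow> i < d"
| "wf_trm d (Num k) \<longleftrightarrow> True"
| "wf_trm d (Plus t u) \<longleftrightarrow> wf_trm d t \<and> wf_trm d u"
| "wf_trm d (Times t u) \<longleftrightarrow> wf_trm d t \<and> wf_trm d u"

datatype fm = At trm nat | Less trm trm | Neg fm | And fm fm | Ex nat fm

definition sym_at :: "nat list \<Rightarrow> nat \<Rightarrow> nat" where
  "sym_at w k = (if k < length w then w ! k else 0)"

text \<open>The range \<open>x \<le> length w\<close> is what a single sweeping head can detect:
  value \<open>length w + 1\<close> is the first at which it reads the blank.\<close>

primrec holds :: "nat list \<Rightarrow> (nat \<Rightarrow> nat) \<Rightarrow> fm \<Rightarrow> bool" where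
  "holds w \<sigma> (At t a) \<longleftrightarrow> sym_at w (val \<sigma> t) = a"
| "holds w \<sigma> (Less t u) \<longleftrightarrow> val \<sigma> t < val \<sigma> u"
| "holds w \<sigma> (Neg f) \<longleftrightarrow> \<not> holds w \<sigma> f"
| "holds w \<sigma> (And f g) \<longleftrightarrow> holds w \<sigma> f \<and> holds w \<sigma> g"
| "holds w \<sigma> (Ex v f) \<longleftrightarrow> (\<exists>x\<le>length w. holds w (\<sigma>(v := x)) f)"

text \<open>The variables below \<open>d\<close> are in scope; all others are free to be used as scratch heads.\<close>

primrec wf_fm :: "nat \<Rightarrow> fm \<Rightarrow> bool" where
  "wf_fm d (At t a) \<longleftrightarrow> wf_trm d t"
| "wf_fm d (Less t u) \<longleftrightarrow> wf_trm d t \<and> wf_trm d u"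
| "wf_fm d (Neg f) \<longleftrightarrow> wf_fm d f"
| "wf_fm d (And f g) \<longleftrightarrow> wf_fm d f \<and> wf_fm d g"
| "wf_fm d (Ex v f) \<longleftrightarrow> d \<le> v \<and> wf_fm (Suc v) f"


subsection \<open>Compilation\<close>

text \<open>The only arithmetic primitive: \<open>c\<close> is executed once per unit stored in head
  \<open>i\<close>. The trailing \<open>Done True\<close> discards the value of \<open>c\<close>, so
  that only the zero test ends the loop.\<close>

definition Drain :: "nat \<Rightarrow> prog \<Rightarrow> prog" where
  "Drain i c = Loop (Cond (Test i 4) (Done False) (Seq (Move i Left) (Seq c (Done True))))"

text \<open>The 9 consists of two steps for each of the three conditionals in the loop body and one
  for each of \<open>Test\<close>, \<open>Move\<close> and \<open>Done\<close>.\<close>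

definition drain_time :: "nat \<Rightarrow> nat \<Rightarrow> nat" where
  "drain_time n B = Suc (Suc n * Suc (B + 9))"

lemma drain_time_mono: "n \<le> n' \<Longrightarrow> B \<le> B' \<Longrightarrow> drain_time n B \<le> drain_time n' B'"
  unfolding drain_time_def by (intro Suc_le_mono[THEN iffD2] mult_le_mono) auto

lemma look_0: "look w 0 = 4"
  by (simp add: look_eq)

lemma look_Suc: "look w (Suc v) = sym_at w v"
  by (auto simp: look_eq sym_at_def)

lemma look_eq_4: "4 \<notin> set w \<Longrightarrow> look w v = 4 \<longleftrightarrow> v = 0"
  by (cases v) (auto simp: look_0 look_Suc sym_at_def dest: nth_mem intro: Nat.gr0I)

lemma look_eq_0: "0 \<notin> set w \<Longrightarrow> look w v = 0 \<longleftrightarrow> length w < v"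
  by (cases v) (auto simp: look_0 look_Suc sym_at_def, metis gr0I nth_mem)

primrec advance :: "nat \<Rightarrow> nat \<Rightarrow> prog" where
  "advance d 0 = Done True"
| "advance d (Suc k) = Seq (Move d Right) (advance d k)"

text \<open>The value is left in head \<open>d\<close>, and all heads from \<open>d\<close> on are
  zero beforehand. Draining destroys its source, so a variable is restored from
  \<open>Suc d\<close>, and in a product the second factor is restored from \<open>d + 3\<close> in
  every round.\<close>

primrec compile_trm :: "trm \<Rightarrow> nat \<Rightarrow> prog" where
  "compile_trm (Var i) d =
    Seq (Drain i (Seq (Move d Right) (Move (Suc d) Right))) (Drain (Suc d) (Move i Right))"
| "compile_trm (Num k) d = advance d k"
| "compile_trm (Plus t u) d =
    Seq (compile_trm t d) (Seq (compile_trm u (Suc d)) (Drain (Suc d) (Move d Right)))"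
| "compile_trm (Times t u) d =
    Seq (compile_trm t (d + 1)) (Seq (compile_trm u (d + 2)) (Seq
      (Drain (d + 1)
        (Seq (Drain (d + 2) (Seq (Move d Right) (Move (d + 3) Right))) (Drain (d + 3) (Move (d + 2) Right))))
      (Drain (d + 2) (Done True))))"

text \<open>\<open>B\<close> bounds the variables in scope, so \<open>val (\<lambda>_. B)\<close>
  bounds the number of rounds of a drain. For a fixed term this grows polynomially in
  \<open>B\<close>.\<close>

primrec trm_time :: "trm \<Rightarrow> nat \<Rightarrow> nat" where
  "trm_time (Var i) B = drain_time B 4 + drain_time B 1 + 2"
| "trm_time (Num k) B = 3 * k + 1"
| "trm_time (Plus t u) B =
    trm_time t B + (trm_time u B + drain_time (val (\<lambda>_. B) u) 1 + 2) + 2"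
| "trm_time (Times t u) B = trm_time t B + (trm_time u B + (drain_time (val (\<lambda>_. B) t)
      (drain_time (val (\<lambda>_. B) u) 4 + drain_time (val (\<lambda>_. B) u) 1 + 2)
    + drain_time (val (\<lambda>_. B) u) 1 + 2) + 2) + 2"

lemma val_mono: "wf_trm e t \<Longrightarrow> (\<And>v. v < e \<Longrightarrow> \<sigma> v \<le> \<tau> v) \<Longrightarrow> val \<sigma> t \<le> val \<tau> t"
  by (induction t) (auto intro: add_mono mult_le_mono)

lemma val_cong: "wf_trm e t \<Longrightarrow> (\<And>v. v < e \<Longrightarrow> \<sigma> v = \<tau> v) \<Longrightarrow> val \<sigma> t = val \<tau> t"
  by (induction t) auto

lemma width_Drain [simp]: "width (Drain i c) = max (Suc i) (width c)"
  by (simp add: Drain_def)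

lemma runs_advance:
  "width (advance d k) \<le> K \<Longrightarrow> runs K w (advance d k) \<sigma> True (\<sigma>(d := \<sigma> d + k)) (3 * k + 1)"
proof (induction k arbitrary: \<sigma>)
  case 0
  then show ?case
    using runs_Done by simp
next
  case (Suc k)
  then have "d < K" "width (advance d k) \<le> K"
    by auto
  from runs_Seq[OF runs_Right[OF this(1)] Suc.IH[OF this(2)]]
  have "runs K w (advance d (Suc k)) \<sigma> True
      ((\<sigma>(d := Suc (\<sigma> d)))(d := (\<sigma>(d := Suc (\<sigma> d))) d + k)) (1 + (3 * k + 1) + 2)"
    unfolding advance.simps .
  moreover have "(\<sigma>(d := Suc (\<sigma> d)))(d := (\<sigma>(d := Suc (\<sigma> d))) d + k) = \<sigma>(d := \<sigma> d + Suc k)"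
    by simp
  ultimately have "runs K w (advance d (Suc k)) \<sigma> True (\<sigma>(d := \<sigma> d + Suc k)) (1 + (3 * k + 1) + 2)"
    by (simp only:)
  then show ?case
    by (rule runs_mono) simp
qed

section \<open>Arithmetic on counters by draining\<close>

context
  fixes K :: nat and w :: "nat list"
  assumes no_marker: "4 \<notin> set w" and no_blank: "0 \<notin> set w"
begin

text \<open>Prescribing the assignments \<open>S\<close> at the loop head gives one rule for all
  bodies. A body starts with head \<open>i\<close> already lowered and may return any truth
  value.\<close>

lemma runs_Drain:
  assumes i: "i < K" and val: "\<And>k. k \<le> n \<Longrightarrow> S k i = n - k"
    and body: "\<And>k. k < n \<Longrightarrow> \<exists>b. runs K w c ((S k)(i := n - Suc k)) b (S (Suc k)) B"
  shows "runs K w (Drain i c) (S 0) True (S n) (drain_time n B)"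
  unfolding Drain_def drain_time_def
proof (rule runs_Loop)
  let ?b = "Cond (Test i 4) (Done False) (Seq (Move i Left) (Seq c (Done True)))"
  show "runs K w ?b (S k) True (S (Suc k)) (B + 9)" if k: "k < n" for k
  proof -
    obtain b where b: "runs K w c ((S k)(i := n - Suc k)) b (S (Suc k)) B"
      using body[OF k] by blast
    have "runs K w (Move i Left) (S k) True ((S k)(i := n - Suc k)) 1"
      using runs_Left[of i K "S k"] i val[of k] k by simp
    from runs_Seq[OF this runs_Seq[OF b runs_Done[of _ _ True]]]
    show ?thesis
      using runs_Cond[OF runs_Test[OF i, of w 4 "S k"]] look_eq_4[OF no_marker] val[of k] k
      by (force elim: runs_mono)
  qed
  show "runs K w ?b (S n) False (S n) (B + 9)"
    using runs_Cond[OF runs_Test[OF i, of w 4 "S n"], of "Done False"] runs_Done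
      look_eq_4[OF no_marker] val[of n]
    by (force elim: runs_mono)
qed

lemma runs_Drain_clear:
  assumes "i < K"
  shows "runs K w (Drain i (Done True)) \<sigma> True (\<sigma>(i := 0)) (drain_time (\<sigma> i) 1)"
proof -
  let ?S = "\<lambda>k. \<sigma>(i := \<sigma> i - k)"
  have "runs K w (Drain i (Done True)) (?S 0) True (?S (\<sigma> i)) (drain_time (\<sigma> i) 1)"
    by (rule runs_Drain[where S = ?S]) (use assms in \<open>auto intro: runs_Done[unfolded One_nat_def]\<close>)
  then show ?thesis by simp
qed

lemma runs_Drain_add:
  assumes "i < K" "j < K" "i \<noteq> j"
  shows "runs K w (Drain i (Move j Right)) \<sigma> True (\<sigma>(i := 0, j := \<sigma> j + \<sigma> i)) (drain_time (\<sigma> i) 1)"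
proof -
  let ?S = "\<lambda>k. \<sigma>(i := \<sigma> i - k, j := \<sigma> j + k)"
  have "runs K w (Drain i (Move j Right)) (?S 0) True (?S (\<sigma> i)) (drain_time (\<sigma> i) 1)"
  proof (rule runs_Drain[where S = ?S])
    fix k
    have "runs K w (Move j Right) ((?S k)(i := \<sigma> i - Suc k)) True
        (((?S k)(i := \<sigma> i - Suc k))(j := Suc (\<sigma> j + k))) 1"
      using runs_Right[of j K w "(?S k)(i := \<sigma> i - Suc k)"] assms by simp
    then show "\<exists>b. runs K w (Move j Right) ((?S k)(i := \<sigma> i - Suc k)) b (?S (Suc k)) 1"
      using assms by (auto simp: fun_upd_twist)
  qed (use assms in auto)
  then show ?thesis by simp
qed

lemma runs_Drain_add2:
  assumes "i < K" "j < K" "l < K" "i \<noteq> j" "i \<noteq> l" "j \<noteq> l"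
  shows "runs K w (Drain i (Seq (Move j Right) (Move l Right))) \<sigma> True
    (\<sigma>(i := 0, j := \<sigma> j + \<sigma> i, l := \<sigma> l + \<sigma> i)) (drain_time (\<sigma> i) 4)"
proof -
  let ?c = "Seq (Move j Right) (Move l Right)"
  let ?S = "\<lambda>k. \<sigma>(i := \<sigma> i - k, j := \<sigma> j + k, l := \<sigma> l + k)"
  have "runs K w (Drain i ?c) (?S 0) True (?S (\<sigma> i)) (drain_time (\<sigma> i) 4)"
  proof (rule runs_Drain[where S = ?S])
    fix k
    let ?T = "(?S k)(i := \<sigma> i - Suc k)"
    have "runs K w ?c ?T True ((?T(j := Suc (?T j)))(l := Suc ((?T(j := Suc (?T j))) l))) 4"
      by (rule runs_mono[OF runs_Seq[OF runs_Right runs_Right]]) (use assms in auto)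
    moreover have "(?T(j := Suc (?T j)))(l := Suc ((?T(j := Suc (?T j))) l)) = ?S (Suc k)"
      using assms by (auto simp: fun_eq_iff)
    ultimately have "runs K w ?c ?T True (?S (Suc k)) 4"
      by (simp only:)
    then show "\<exists>b. runs K w ?c ?T b (?S (Suc k)) 4"
      by blast
  qed (use assms in auto)
  then show ?thesis by simp
qed

text \<open>The guard keeps head \<open>j\<close> from passing the end marker, which is exactly
  truncated subtraction.\<close>

lemma runs_Drain_diff:
  assumes "i < K" "j < K" "i \<noteq> j"
  shows "runs K w (Drain i (Cond (Test j 4) (Done True) (Move j Left))) \<sigma> True
    (\<sigma>(i := 0, j := \<sigma> j - \<sigma> i)) (drain_time (\<sigma> i) 4)"
proof -
  let ?c = "Cond (Test j 4) (Done True) (Move j Left)"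
  let ?S = "\<lambda>k. \<sigma>(i := \<sigma> i - k, j := \<sigma> j - k)"
  have "runs K w (Drain i ?c) (?S 0) True (?S (\<sigma> i)) (drain_time (\<sigma> i) 4)"
  proof (rule runs_Drain[where S = ?S])
    fix k
    let ?T = "(?S k)(i := \<sigma> i - Suc k)"
    have "runs K w (if look w (?T j) = 4 then Done True else Move j Left) ?T True (?T(j := ?T j - 1)) 1"
    proof (cases "?T j = 0")
      case True
      then have "?T(j := ?T j - 1) = ?T"
        by (auto simp: fun_eq_iff)
      then show ?thesis
        using True runs_Done look_eq_4[OF no_marker] by simp
    next
      case False
      then show ?thesis
        using runs_Left[of j K ?T] assms look_eq_4[OF no_marker] by simp
    qed
    from runs_Cond[OF runs_Test[OF assms(2)] this]
    have "runs K w ?c ?T True (?T(j := ?T j - 1)) 4"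
      by (rule runs_mono) simp
    moreover have "?T(j := ?T j - 1) = ?S (Suc k)"
      using assms by (auto simp: fun_eq_iff)
    ultimately show "\<exists>b. runs K w ?c ?T b (?S (Suc k)) 4"
      by auto
  qed (use assms in auto)
  then show ?thesis by simp
qed

text \<open>Each round moves \<open>j\<close> to \<open>l\<close> and \<open>m\<close>
  simultaneously and then \<open>m\<close> back to \<open>j\<close>; as \<open>m\<close> starts at
  zero, \<open>j\<close> regains its value and all rounds cost the same.\<close>

lemma runs_Drain_mult:
  assumes "i < K" "j < K" "l < K" "m < K" "distinct [i, j, l, m]" "\<sigma> m = 0"
  shows "runs K w (Drain i (Seq (Drain j (Seq (Move l Right) (Move m Right))) (Drain m (Move j Right))))
    \<sigma> True (\<sigma>(i := 0, l := \<sigma> l + \<sigma> i * \<sigma> j))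
    (drain_time (\<sigma> i) (drain_time (\<sigma> j) 4 + drain_time (\<sigma> j) 1 + 2))"
proof -
  let ?c = "Seq (Drain j (Seq (Move l Right) (Move m Right))) (Drain m (Move j Right))"
  let ?B = "drain_time (\<sigma> j) 4 + drain_time (\<sigma> j) 1 + 2"
  let ?S = "\<lambda>k. \<sigma>(i := \<sigma> i - k, l := \<sigma> l + k * \<sigma> j)"
  have "runs K w (Drain i ?c) (?S 0) True (?S (\<sigma> i)) (drain_time (\<sigma> i) ?B)"
  proof (rule runs_Drain[where S = ?S])
    fix k
    let ?T = "(?S k)(i := \<sigma> i - Suc k)"
    let ?U = "?T(j := 0, l := ?T l + ?T j, m := ?T m + ?T j)"
    have "runs K w ?c ?T True (?U(m := 0, j := ?U j + ?U m))
        (drain_time (?T j) 4 + drain_time (?U m) 1 + 2)"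
      by (rule runs_Seq[OF runs_Drain_add2 runs_Drain_add]) (use assms in auto)
    moreover have "?U(m := 0, j := ?U j + ?U m) = ?S (Suc k)"
      using assms by (auto simp: fun_eq_iff)
    moreover have "?T j = \<sigma> j" "?U m = \<sigma> j"
      using assms by auto
    ultimately have "runs K w ?c ?T True (?S (Suc k)) ?B"
      by (simp only:)
    then show "\<exists>b. runs K w ?c ?T b (?S (Suc k)) ?B"
      by blast
  qed (use assms in auto)
  then show ?thesis by simp
qed

text \<open>The scope \<open>e\<close> is separate from the first free head \<open>d\<close>: it
  stays fixed in the induction, while \<open>d\<close> climbs past the intermediate results.\<close>

lemma runs_compile_trm:
  assumes "wf_trm e t" "e \<le> d" "\<And>v. v \<ge> d \<Longrightarrow> \<sigma> v = 0" "\<And>v. v < e \<Longrightarrow> \<sigma> v \<le> B"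
    and "width (compile_trm t d) \<le> K"
  shows "runs K w (compile_trm t d) \<sigma> True (\<sigma>(d := val \<sigma> t)) (trm_time t B)"
  using assms
proof (induction t arbitrary: d \<sigma>)
  case (Var i)
  let ?T = "\<sigma>(i := 0, d := \<sigma> d + \<sigma> i, Suc d := \<sigma> (Suc d) + \<sigma> i)"
  have "runs K w (compile_trm (Var i) d) \<sigma> True (?T(Suc d := 0, i := ?T i + ?T (Suc d)))
      (drain_time (\<sigma> i) 4 + drain_time (?T (Suc d)) 1 + 2)"
    unfolding compile_trm.simps
    by (rule runs_Seq[OF runs_Drain_add2 runs_Drain_add])
      (use Var.prems in auto)
  moreover have "?T(Suc d := 0, i := ?T i + ?T (Suc d)) = \<sigma>(d := \<sigma> i)"
    using Var.prems by (auto simp: fun_eq_iff)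
  moreover have "drain_time (\<sigma> i) 4 + drain_time (?T (Suc d)) 1 + 2 \<le> trm_time (Var i) B"
    using Var.prems by (auto intro!: add_mono drain_time_mono)
  ultimately show ?case
    by (metis runs_mono val.simps(1))
next
  case (Num k)
  then show ?case
    using runs_advance[of d k K w \<sigma>] by (simp add: fun_upd_def)
next
  case (Plus t u)
  let ?T = "\<sigma>(d := val \<sigma> t)"
  let ?U = "?T(Suc d := val ?T u)"
  have u: "val ?T u = val \<sigma> u"
    using Plus.prems by (intro val_cong[of e]) auto
  have "runs K w (compile_trm (Plus t u) d) \<sigma> True (?U(Suc d := 0, d := ?U d + ?U (Suc d)))
      (trm_time t B + (trm_time u B + drain_time (?U (Suc d)) 1 + 2) + 2)"
    unfolding compile_trm.simps
    by (rule runs_Seq[OF Plus.IH(1) runs_Seq[OF Plus.IH(2) runs_Drain_add]])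
      (use Plus.prems in auto)
  moreover have "?U(Suc d := 0, d := ?U d + ?U (Suc d)) = \<sigma>(d := val \<sigma> (Plus t u))"
    using Plus.prems u by (auto simp: fun_eq_iff)
  moreover have "val \<sigma> u \<le> val (\<lambda>_. B) u"
    using Plus.prems by (intro val_mono[of e]) auto
  then have "trm_time t B + (trm_time u B + drain_time (?U (Suc d)) 1 + 2) + 2 \<le> trm_time (Plus t u) B"
    using u by (auto intro!: drain_time_mono)
  ultimately show ?case
    by (metis runs_mono)
next
  case (Times t u)
  let ?T = "\<sigma>(d + 1 := val \<sigma> t)"
  let ?U = "?T(d + 2 := val ?T u)"
  let ?V = "?U(d + 1 := 0, d := ?U d + ?U (d + 1) * ?U (d + 2))"
  let ?B = "trm_time t B + (trm_time u B + (drain_time (?U (d + 1))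
      (drain_time (?U (d + 2)) 4 + drain_time (?U (d + 2)) 1 + 2)
    + drain_time (?V (d + 2)) 1 + 2) + 2) + 2"
  have u: "val ?T u = val \<sigma> u"
    using Times.prems by (intro val_cong[of e]) auto
  have runs: "runs K w (compile_trm (Times t u) d) \<sigma> True (?V(d + 2 := 0)) ?B"
    unfolding compile_trm.simps
    by (rule runs_Seq[OF Times.IH(1) runs_Seq[OF Times.IH(2)
          runs_Seq[OF runs_Drain_mult runs_Drain_clear]]])
      (use Times.prems in auto)
  have eq: "?V(d + 2 := 0) = \<sigma>(d := val \<sigma> (Times t u))"
    using Times.prems u by (auto simp: fun_eq_iff)
  have "val \<sigma> t \<le> val (\<lambda>_. B) t" "val \<sigma> u \<le> val (\<lambda>_. B) u"
    using Times.prems by (auto intro!: val_mono[of e])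
  then have "?B \<le> trm_time (Times t u) B"
    using u by (auto intro!: add_mono drain_time_mono)
  from runs_mono[OF runs[unfolded eq] this] show ?case .
qed

end


subsection \<open>Compilation of formulas\<close>

abbreviation clear :: "nat \<Rightarrow> bool \<Rightarrow> prog" where
  "clear d b \<equiv> Seq (Drain d (Done True)) (Done b)"

text \<open>Unlike terms, formulas leave every head as they found it. The verdict lives in the
  control, so scratch heads are cleared only after the test, separately in both branches.
  \<open>At\<close> shifts by one because head value \<open>Suc v\<close> reads position
  \<open>v\<close>.\<close>

primrec compile_fm :: "fm \<Rightarrow> nat \<Rightarrow> prog" where
  "compile_fm (At t a) d =
    Seq (compile_trm t d) (Seq (Move d Right) (Cond (Test d a) (clear d True) (clear d False)))"
| "compile_fm (Less t u) d =
    Seq (compile_trm t d) (Seq (compile_trm u (Suc d)) (Seq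
      (Drain d (Cond (Test (Suc d) 4) (Done True) (Move (Suc d) Left)))
      (Cond (Test (Suc d) 4) (clear (Suc d) False) (clear (Suc d) True))))"
| "compile_fm (Neg f) d = Cond (compile_fm f d) (Done False) (Done True)"
| "compile_fm (And f g) d = Cond (compile_fm f d) (compile_fm g d) (Done False)"
| "compile_fm (Ex v f) d =
    Seq (Loop (Cond (Test v 0) (Done False) (Cond (compile_fm f (Suc v)) (Done False) (Move v Right))))
      (Cond (Test v 0) (clear v False) (clear v True))"

text \<open>In the \<open>Ex\<close> clause, \<open>B + 2\<close> accounts for the values
  \<open>0\<close> to \<open>length w + 1\<close>, the last of which meets the blank.\<close>

primrec fm_time :: "fm \<Rightarrow> nat \<Rightarrow> nat" where
  "fm_time (At t a) B = trm_time t B + (drain_time (Suc (val (\<lambda>_. B) t)) 1 + 9) + 2"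
| "fm_time (Less t u) B = trm_time t B + (trm_time u B + (drain_time (val (\<lambda>_. B) t) 4
    + (drain_time (val (\<lambda>_. B) u) 1 + 6) + 2) + 2) + 2"
| "fm_time (Neg f) B = fm_time f B + 3"
| "fm_time (And f g) B = fm_time f B + fm_time g B + 3"
| "fm_time (Ex v f) B = Suc ((B + 2) * Suc (fm_time f B + 6)) + (drain_time (Suc B) 1 + 6) + 2"

context
  fixes K :: nat and w :: "nat list"
  assumes no_marker: "4 \<notin> set w" and no_blank: "0 \<notin> set w"
begin

lemma runs_clear:
  assumes "d < K" "\<sigma>(d := 0) = \<tau>"
  shows "runs K w (clear d b) \<sigma> b \<tau> (drain_time (\<sigma> d) 1 + 3)"
  using runs_Seq[OF runs_Drain_clear[OF no_marker no_blank assms(1)] runs_Done] assms(2)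
  by (force elim: runs_mono)

lemma runs_test_clear:
  assumes "d < K" "\<sigma>(d := 0) = \<tau>" "look w (\<sigma> d) = a \<longleftrightarrow> r"
  shows "runs K w (Cond (Test d a) (clear d b) (clear d c)) \<sigma> (if r then b else c) \<tau>
    (drain_time (\<sigma> d) 1 + 6)"
proof -
  have "runs K w (if look w (\<sigma> d) = a then clear d b else clear d c) \<sigma> (if r then b else c) \<tau>
      (drain_time (\<sigma> d) 1 + 3)"
    using runs_clear[OF assms(1,2)] assms(3) by simp
  from runs_Cond[OF runs_Test[OF assms(1)] this] show ?thesis
    by (rule runs_mono) simp
qed

lemma runs_compile_fm:
  assumes "wf_fm d f" "\<And>v. v \<ge> d \<Longrightarrow> \<sigma> v = 0" "\<And>v. v < d \<Longrightarrow> \<sigma> v \<le> B"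
    and "length w \<le> B" "width (compile_fm f d) \<le> K"
  shows "runs K w (compile_fm f d) \<sigma> (holds w \<sigma> f) \<sigma> (fm_time f B)"
  using assms
proof (induction f arbitrary: d \<sigma>)
  case (At t a)
  let ?T = "\<sigma>(d := val \<sigma> t)"
  let ?U = "?T(d := Suc (?T d))"
  have runs: "runs K w (compile_fm (At t a) d) \<sigma> (if holds w \<sigma> (At t a) then True else False) \<sigma>
      (trm_time t B + (1 + (drain_time (?U d) 1 + 6) + 2) + 2)"
    unfolding compile_fm.simps
    by (rule runs_Seq[OF runs_compile_trm[OF no_marker no_blank] runs_Seq[OF runs_Right runs_test_clear]])
      (use At.prems in \<open>auto simp: look_Suc fun_eq_iff\<close>)
  have "val \<sigma> t \<le> val (\<lambda>_. B) t"
    using At.prems by (intro val_mono[of d]) auto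
  then have "trm_time t B + (1 + (drain_time (?U d) 1 + 6) + 2) + 2 \<le> fm_time (At t a) B"
    using drain_time_mono[of "?U d" "Suc (val (\<lambda>_. B) t)" 1 1] by simp
  from runs_mono[OF runs this] show ?case
    by (simp del: compile_fm.simps fm_time.simps split: if_splits)
next
  case (Less t u)
  let ?T = "\<sigma>(d := val \<sigma> t)"
  let ?U = "?T(Suc d := val ?T u)"
  let ?V = "?U(d := 0, Suc d := ?U (Suc d) - ?U d)"
  let ?B = "trm_time t B + (trm_time u B + (drain_time (?U d) 4
    + (drain_time (?V (Suc d)) 1 + 6) + 2) + 2) + 2"
  have u: "val ?T u = val \<sigma> u"
    using Less.prems by (intro val_cong[of d]) auto
  \<comment> \<open>After the drain, head \<open>Suc d\<close> holds the truncated difference of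
    \<open>u\<close> and \<open>t\<close>, which is zero exactly if \<open>t < u\<close> fails. The
    conditional is spelled out to match \<open>runs_test_clear\<close>.\<close>
  have runs: "runs K w (compile_fm (Less t u) d) \<sigma> (if \<not> holds w \<sigma> (Less t u) then False else True) \<sigma> ?B"
    unfolding compile_fm.simps
    by (rule runs_Seq[OF runs_compile_trm[OF no_marker no_blank, of d]
          runs_Seq[OF runs_compile_trm[OF no_marker no_blank, of d]
          runs_Seq[OF runs_Drain_diff[OF no_marker no_blank] runs_test_clear]]])
      (use Less.prems u in \<open>auto simp: look_eq_4[OF no_marker] fun_eq_iff\<close>)
  have "val \<sigma> t \<le> val (\<lambda>_. B) t" "val \<sigma> u \<le> val (\<lambda>_. B) u"
    using Less.prems by (auto intro!: val_mono[of d])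
  then have "?B \<le> fm_time (Less t u) B"
    using u by (auto intro!: add_mono drain_time_mono)
  from runs_mono[OF runs this] show ?case
    by (simp del: compile_fm.simps fm_time.simps split: if_splits)
next
  case (Neg f)
  have "runs K w (compile_fm f d) \<sigma> (holds w \<sigma> f) \<sigma> (fm_time f B)"
    using Neg by auto
  moreover have "runs K w (if holds w \<sigma> f then Done False else Done True) \<sigma> (holds w \<sigma> (Neg f)) \<sigma> 1"
    by (simp add: runs_Done[unfolded One_nat_def])
  ultimately have "runs K w (compile_fm (Neg f) d) \<sigma> (holds w \<sigma> (Neg f)) \<sigma> (fm_time f B + 1 + 2)"
    unfolding compile_fm.simps by (rule runs_Cond)
  then show ?case
    by (rule runs_mono) simp
next
  case (And f g)
  have f: "runs K w (compile_fm f d) \<sigma> (holds w \<sigma> f) \<sigma> (fm_time f B)"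
    using And by auto
  have g: "runs K w (compile_fm g d) \<sigma> (holds w \<sigma> g) \<sigma> (fm_time g B)"
    using And by auto
  have "runs K w (if holds w \<sigma> f then compile_fm g d else Done False) \<sigma> (holds w \<sigma> (And f g)) \<sigma>
      (fm_time g B + 1)"
    using runs_mono[OF g, of "fm_time g B + 1"] runs_mono[OF runs_Done[of K w False \<sigma>], of "fm_time g B + 1"] by simp
  from runs_Cond[OF f this] show ?case
    unfolding compile_fm.simps by (rule runs_mono) simp
next
  case (Ex v f)
  let ?S = "\<lambda>k. \<sigma>(v := k)"
  let ?c = "Cond (compile_fm f (Suc v)) (Done False) (Move v Right)"
  let ?stop = "\<lambda>k. k > length w \<or> holds w (?S k) f"
  \<comment> \<open>The sweep stops at the least witness or, if there is none, just past the word;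
    the final test of head \<open>v\<close> for a blank tells the two apart.\<close>
  define n where "n = (LEAST k. ?stop k)"
  have end_stop: "?stop (Suc (length w))"
    by simp
  have n: "?stop n" "n \<le> Suc (length w)" "\<And>k. k < n \<Longrightarrow> \<not> ?stop k"
    unfolding n_def
    by (fact LeastI[of ?stop, OF end_stop], fact Least_le[of ?stop, OF end_stop], rule not_less_Least)
  have S0: "?S 0 = \<sigma>"
    using Ex.prems by (auto simp: fun_eq_iff)
  have v: "v < K"
    using Ex.prems by simp
  have f: "runs K w (compile_fm f (Suc v)) (?S k) (holds w (?S k) f) (?S k) (fm_time f B)"
    if k: "k \<le> length w" for k
  proof (rule Ex.IH)
    show "?S k u \<le> B" for u
      using Ex.prems(2,3)[of u] Ex.prems(4) k by (cases "u < d") auto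
  qed (use Ex.prems in auto)
  have body: "runs K w ?c (?S k) (\<not> holds w (?S k) f) (if holds w (?S k) f then ?S k else ?S (Suc k))
      (fm_time f B + 3)" if "k \<le> length w" for k
  proof -
    have "runs K w (if holds w (?S k) f then Done False else Move v Right) (?S k)
        (\<not> holds w (?S k) f) (if holds w (?S k) f then ?S k else ?S (Suc k)) 1"
      using runs_Done runs_Right[OF v, of w "?S k"] by simp
    from runs_Cond[OF f[OF that] this] show ?thesis
      by (rule runs_mono) simp
  qed
  have loop: "runs K w (Cond (Test v 0) (Done False) ?c) (?S k) (\<not> ?stop k)
      (if ?stop k then ?S k else ?S (Suc k)) (fm_time f B + 6)" for k
  proof -
    have "look w (?S k v) = 0 \<longleftrightarrow> length w < k"
      using look_eq_0[OF no_blank] by simp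
    then have "runs K w (if look w (?S k v) = 0 then Done False else ?c) (?S k) (\<not> ?stop k)
      (if ?stop k then ?S k else ?S (Suc k)) (fm_time f B + 3)"
      using body[of k] runs_mono[OF runs_Done[of K w False "?S k"], of "fm_time f B + 3"]
      by (auto simp: not_less)
    from runs_Cond[OF runs_Test[OF v] this] show ?thesis
      by (rule runs_mono) simp
  qed
  have "runs K w (Loop (Cond (Test v 0) (Done False) ?c)) (?S 0) True (?S n)
      (Suc (Suc n * Suc (fm_time f B + 6)))"
  proof (rule runs_Loop[where S = ?S])
    fix k
    assume "k < n"
    then show "runs K w (Cond (Test v 0) (Done False) ?c) (?S k) True (?S (Suc k)) (fm_time f B + 6)"
      using loop[of k] n(3)[of k] by (simp split: if_splits)
  next
    show "runs K w (Cond (Test v 0) (Done False) ?c) (?S n) False (?S n) (fm_time f B + 6)"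
      using loop[of n] n(1) by (simp split: if_splits)
  qed
  moreover have "runs K w (Cond (Test v 0) (clear v False) (clear v True)) (?S n)
      (if length w < n then False else True) \<sigma> (drain_time (?S n v) 1 + 6)"
    using v S0 by (intro runs_test_clear) (simp_all add: look_eq_0[OF no_blank])
  ultimately have runs: "runs K w (compile_fm (Ex v f) d) \<sigma> (if length w < n then False else True) \<sigma>
      (Suc (Suc n * Suc (fm_time f B + 6)) + (drain_time (?S n v) 1 + 6) + 2)"
    unfolding compile_fm.simps S0 by (rule runs_Seq)
  have eq: "(if length w < n then False else True) = holds w \<sigma> (Ex v f)"
    using n by (auto simp: not_less)
  have "Suc (Suc n * Suc (fm_time f B + 6)) + (drain_time (?S n v) 1 + 6) + 2
      \<le> fm_time (Ex v f) B"
  proof -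
    have "n \<le> Suc B"
      using n(2) Ex.prems by linarith
    then have "Suc n * Suc (fm_time f B + 6) \<le> (B + 2) * Suc (fm_time f B + 6)"
      "drain_time n 1 \<le> drain_time (Suc B) 1"
      by (auto intro!: mult_le_mono1 drain_time_mono simp del: mult_Suc mult_Suc_right)
    then show ?thesis
      by simp
  qed
  from runs_mono[OF runs[unfolded eq] this] show ?case .
qed

end


subsection \<open>Polynomial running time\<close>

definition poly_bounded :: "(nat \<Rightarrow> nat) \<Rightarrow> bool" where
  "poly_bounded f \<longleftrightarrow> (\<exists>p. \<forall>n. f n \<le> poly p n)"

lemma poly_bounded_const: "poly_bounded (\<lambda>_. c)"
  unfolding poly_bounded_def by (intro exI[of _ "[:c:]"]) simp

lemma poly_bounded_ident: "poly_bounded (\<lambda>n. n)"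
  unfolding poly_bounded_def by (intro exI[of _ "[:0, 1:]"]) simp

lemma poly_bounded_add: "poly_bounded f \<Longrightarrow> poly_bounded g \<Longrightarrow> poly_bounded (\<lambda>n. f n + g n)"
  unfolding poly_bounded_def by (metis add_mono poly_add)

lemma poly_bounded_mult: "poly_bounded f \<Longrightarrow> poly_bounded g \<Longrightarrow> poly_bounded (\<lambda>n. f n * g n)"
  unfolding poly_bounded_def by (metis mult_le_mono poly_mult)

lemma poly_bounded_Suc: "poly_bounded f \<Longrightarrow> poly_bounded (\<lambda>n. Suc (f n))"
  using poly_bounded_add[OF _ poly_bounded_const[of 1]] by simp

lemma poly_bounded_power: "poly_bounded f \<Longrightarrow> poly_bounded (\<lambda>n. f n ^ k)"
  by (induction k) (simp_all add: poly_bounded_const poly_bounded_mult)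

lemma poly_bounded_drain_time:
  "poly_bounded f \<Longrightarrow> poly_bounded g \<Longrightarrow> poly_bounded (\<lambda>n. drain_time (f n) (g n))"
  unfolding drain_time_def
  by (intro poly_bounded_Suc poly_bounded_mult poly_bounded_add poly_bounded_const)

lemmas poly_bounded_intros = poly_bounded_const poly_bounded_ident poly_bounded_add
  poly_bounded_mult poly_bounded_Suc poly_bounded_power poly_bounded_drain_time

lemma poly_bounded_val: "poly_bounded (\<lambda>B. val (\<lambda>_. B) t)"
  by (induction t) (simp_all add: poly_bounded_intros)

lemma poly_bounded_trm_time: "poly_bounded (trm_time t)"
proof (induction t)
  case (Times t u)
  then show ?case
    unfolding trm_time.simps by (intro poly_bounded_intros poly_bounded_val)
qed (auto intro!: poly_bounded_intros poly_bounded_val)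

lemma poly_bounded_fm_time: "poly_bounded (fm_time f)"
  by (induction f) (auto intro!: poly_bounded_intros poly_bounded_val poly_bounded_trm_time)

text \<open>A sentence starts with all heads at zero, so the input length itself can serve as the
  bound \<open>B\<close>. The alphabet keeps the blank \<open>0\<close> and the marker
  \<open>4\<close> out of the word.\<close>

lemma sentence_decidable:
  assumes "wf_fm 0 f"
  obtains T q where "wf_tm T"
    "\<And>w. set w \<subseteq> {1, 2, 3} \<Longrightarrow> halts_within T w (poly q (length w))"
    "\<And>w. set w \<subseteq> {1, 2, 3} \<Longrightarrow> accepts T w \<longleftrightarrow> holds w (\<lambda>_. 0) f"
proof -
  define c where "c = compile_fm f 0"
  define K where "K = Suc (width c)"
  have "poly_bounded (\<lambda>n. 2 * n + 4 + fm_time f n)"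
    by (intro poly_bounded_intros poly_bounded_fm_time)
  then obtain q where q: "\<And>n. 2 * n + 4 + fm_time f n \<le> poly q n"
    unfolding poly_bounded_def by blast
  have *: "reaches c (poly q (length w)) (Left_End, input_tape w # replicate (K - 1) blank_tape)
      (Ret (holds w (\<lambda>_. 0) f) [], tapes_of K w (\<lambda>_. 0))" if "set w \<subseteq> {1, 2, 3}" for w
  proof -
    have w: "4 \<notin> set w" "0 \<notin> set w"
      using that by auto
    have "reaches c (2 * length w + 4) (Left_End, input_tape w # replicate (K - 1) blank_tape)
        (Run c [], tapes_of K w (\<lambda>_. 0))"
      by (rule reaches_Run) (use w in \<open>auto simp: K_def\<close>)
    moreover have "runs K w c (\<lambda>_. 0) (holds w (\<lambda>_. 0) f) (\<lambda>_. 0) (fm_time f (length w))"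
      unfolding c_def by (rule runs_compile_fm[OF w assms]) (auto simp: K_def c_def)
    then have "reaches c (fm_time f (length w)) (Run c [], tapes_of K w (\<lambda>_. 0))
        (Ret (holds w (\<lambda>_. 0) f) [], tapes_of K w (\<lambda>_. 0))"
      unfolding runs_def by blast
    ultimately show ?thesis
      using q by (blast intro: reaches_mono reaches_trans)
  qed
  show thesis
    by (rule that[of "machine K c" q])
      (use wf_machine[of K c] machine_verdict[OF *] in \<open>auto simp: K_def\<close>)
qed


section \<open>Short certificates\<close>

lemma seq_rel_single: "seq_rel M [X] = Id"
  by (simp add: seq_rel_def)

lemma seq_rel_Cons: "seq_rel M (X # Y # Ds) = star_rel M X Y O seq_rel M (Y # Ds)"
  by (simp add: seq_rel_def)

text \<open>\<open>seq_rel\<close> unfolds at the front, whereas images of a starting point grow at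
  the end.\<close>

lemma seq_rel_snoc: "seq_rel M (Ds @ [X, Y]) = seq_rel M (Ds @ [X]) O star_rel M X Y"
proof (induction Ds)
  case (Cons Z Ds)
  then show ?case
    by (cases Ds) (auto simp: seq_rel_Cons seq_rel_single O_assoc)
qed (simp add: seq_rel_Cons seq_rel_single)

lemma seq_rel_upt_0: "seq_rel M (map D [0..<Suc 0]) = Id"
  by (simp add: seq_rel_single)

lemma seq_rel_upt_Suc:
  "seq_rel M (map D [0..<Suc (Suc t)]) =
    seq_rel M (map D [0..<Suc t]) O star_rel M (D t) (D (Suc t))"
  using seq_rel_snoc[of M "map D [0..<t]" "D t" "D (Suc t)"] by simp

lemma seq_rel_upt_path:
  "(x, y) \<in> seq_rel M (map D [0..<Suc k]) \<longleftrightarrow>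
    (\<exists>f. f 0 = x \<and> f k = y \<and> (\<forall>t<k. (f t, f (Suc t)) \<in> star_rel M (D t) (D (Suc t))))"
proof (induction k arbitrary: y)
  case 0
  show ?case
    by (auto simp: seq_rel_single)
next
  case (Suc k)
  show ?case
  proof
    assume "(x, y) \<in> seq_rel M (map D [0..<Suc (Suc k)])"
    then obtain z where z: "(x, z) \<in> seq_rel M (map D [0..<Suc k])"
      "(z, y) \<in> star_rel M (D k) (D (Suc k))"
      unfolding seq_rel_upt_Suc by blast
    then obtain f where "f 0 = x" "f k = z" "\<forall>t<k. (f t, f (Suc t)) \<in> star_rel M (D t) (D (Suc t))"
      using Suc by blast
    with z show "\<exists>f. f 0 = x \<and> f (Suc k) = y \<and>
        (\<forall>t<Suc k. (f t, f (Suc t)) \<in> star_rel M (D t) (D (Suc t)))"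
      by (intro exI[of _ "f(Suc k := y)"]) (auto simp: less_Suc_eq)
  next
    assume "\<exists>f. f 0 = x \<and> f (Suc k) = y \<and>
        (\<forall>t<Suc k. (f t, f (Suc t)) \<in> star_rel M (D t) (D (Suc t)))"
    then obtain f where "f 0 = x" "f (Suc k) = y"
      "\<forall>t<Suc k. (f t, f (Suc t)) \<in> star_rel M (D t) (D (Suc t))"
      by blast
    then have "(x, f k) \<in> seq_rel M (map D [0..<Suc k])" "(f k, y) \<in> star_rel M (D k) (D (Suc k))"
      using Suc by auto
    then show "(x, y) \<in> seq_rel M (map D [0..<Suc (Suc k)])"
      unfolding seq_rel_upt_Suc by blast
  qed
qed

text \<open>
  \<open>P 0 t\<close> is the set \<open>D\<^sub>t\<close> of the sequence; \<open>P 1 t\<close> and \<open>P 2 t\<close> are the sets of elements of \<open>D\<^sub>t\<close>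
  related to two elements of \<open>D\<^sub>0\<close>. Their final values intersect but \<open>P 1 k\<close> is not contained in
  \<open>P 2 k\<close>, which is how rectangularity fails.
\<close>

definition certificate :: "nat \<Rightarrow> nat matrix \<Rightarrow> nat \<Rightarrow> (nat \<Rightarrow> nat \<Rightarrow> nat \<Rightarrow> bool) \<Rightarrow> bool" where
  "certificate n M k P \<longleftrightarrow> 0 < k \<and>
    (\<forall>s\<le>k. \<forall>t\<le>k.
      (\<forall>i<n. \<forall>j<n. P 0 s i \<and> P 0 t j \<longrightarrow> M i j \<noteq> Zero) \<or>
      (\<forall>i<n. \<forall>j<n. P 0 s i \<and> P 0 t j \<longrightarrow> M i j \<noteq> One)) \<and>
    (\<forall>a\<in>{1, 2}. (\<exists>i<n. P 0 0 i \<and> (\<forall>j<n. P a 0 j \<longleftrightarrow> j = i)) \<and>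
      (\<forall>t<k. \<forall>j<n. P a (Suc t) j \<longleftrightarrow> P 0 (Suc t) j \<and> (\<exists>i<n. P a t i \<and> M i j = Star))) \<and>
    (\<exists>i<n. P 1 k i \<and> P 2 k i) \<and> (\<exists>i<n. P 1 k i \<and> \<not> P 2 k i)"

lemma certificate_cong:
  assumes "\<And>i j. i < n \<Longrightarrow> j < n \<Longrightarrow> M i j = M' i j"
    and "\<And>a t i. a < 3 \<Longrightarrow> t \<le> k \<Longrightarrow> i < n \<Longrightarrow> P a t i = P' a t i"
  shows "certificate n M k P \<longleftrightarrow> certificate n M' k P'"
  unfolding certificate_def using assms by (simp cong: conj_cong)

text \<open>The recurrences for \<open>P 1\<close> and \<open>P 2\<close> are equivalences, so below
  \<open>n\<close> they describe the exact images of the starting points. Exactness matters for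
  \<open>P 2\<close>: an element outside \<open>P 2 k\<close> must be unreachable by every
  path.\<close>

lemma certificate_sound:
  assumes "certificate n M k P"
  shows "derect_seq {..<n} M (map (\<lambda>t. {i. i < n \<and> P 0 t i}) [0..<Suc k])"
proof -
  define D where "D t = {i. i < n \<and> P 0 t i}" for t
  define R where "R t = seq_rel M (map D [0..<Suc t])" for t
  have reach: "\<exists>i. R k `` {i} = {j. j < n \<and> P a k j}" if a: "a \<in> {1, 2}" for a
  proof -
    note cert = assms[unfolded certificate_def, THEN conjunct2, THEN conjunct2, THEN conjunct1,
        THEN bspec, OF a]
    obtain i where i: "i < n" "P 0 0 i" "\<forall>j<n. P a 0 j \<longleftrightarrow> j = i"
      using cert by blast
    have step: "\<forall>t<k. \<forall>j<n. P a (Suc t) j \<longleftrightarrow> P 0 (Suc t) j \<and> (\<exists>i<n. P a t i \<and> M i j = Star)"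
      using cert by blast
    \<comment> \<open>The inclusion is carried along because \<open>star_rel\<close> also restricts
      its source to \<open>D t\<close>, while the recurrence in the certificate mentions only
      \<open>P a t\<close>.\<close>
    have "R t `` {i} = {j. j < n \<and> P a t j} \<and> R t `` {i} \<subseteq> D t" if "t \<le> k" for t
      using that
    proof (induction t)
      case 0
      then show ?case
        using i by (auto simp: R_def D_def seq_rel_upt_0 simp del: upt_Suc)
    next
      case (Suc t)
      then have IH: "R t `` {i} = {j. j < n \<and> P a t j}" "R t `` {i} \<subseteq> D t"
        by auto
      have "R (Suc t) `` {i} = star_rel M (D t) (D (Suc t)) `` (R t `` {i})"
        unfolding R_def seq_rel_upt_Suc by blast
      also have "\<dots> = {j \<in> D (Suc t). \<exists>i'\<in>R t `` {i}. M i' j = Star}"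
        using IH(2) by (auto simp: star_rel_def)
      also have "\<dots> = {j. j < n \<and> P a (Suc t) j}"
        unfolding IH(1) using step Suc.prems by (auto simp: D_def)
      finally show ?case
        using step Suc.prems by (auto simp: D_def)
    qed
    then show ?thesis
      by blast
  qed
  obtain i j where i: "R k `` {i} = {j. j < n \<and> P 1 k j}" and j: "R k `` {j} = {j. j < n \<and> P 2 k j}"
    using reach[of 1] reach[of 2] by auto
  obtain i' j' where "i' < n" "P 1 k i'" "P 2 k i'" "j' < n" "P 1 k j'" "\<not> P 2 k j'"
    using assms[unfolded certificate_def, THEN conjunct2, THEN conjunct2, THEN conjunct2] by blast
  then have "(i, i') \<in> R k" "(i, j') \<in> R k" "(j, i') \<in> R k" "(j, j') \<notin> R k"
    using i j by blast+
  then have "\<not> rectangular (R k)"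
    unfolding rectangular_def by blast
  moreover have "pure_on M (D s) (D t)" if "s \<le> k" "t \<le> k" for s t
    using assms[unfolded certificate_def, THEN conjunct2, THEN conjunct1, rule_format, OF that]
    unfolding pure_on_def D_def by blast
  then have "purifying M (D ` {..k})"
    unfolding purifying_def by simp
  moreover have "0 < k"
    using assms[unfolded certificate_def, THEN conjunct1] .
  moreover have "set (map D [0..<Suc k]) = D ` {..k}"
    by (simp add: atLeast0LessThan lessThan_Suc_atMost del: upt_Suc)
  ultimately have "derect_seq {..<n} M (map D [0..<Suc k])"
    unfolding derect_seq_def R_def by (auto simp: D_def simp del: upt_Suc)
  then show ?thesis
    unfolding D_def .
qed

text \<open>A nonempty set of at most three elements is listed by a triple, possibly with
  repetitions; the summand 1 is for the empty set.\<close>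

lemma card_small_subsets: "card {X. X \<subseteq> {..<n::nat} \<and> card X \<le> 3} \<le> n ^ 3 + 1"
proof -
  let ?f = "\<lambda>(p, q, r). {p, q, r}" and ?N = "{..<n} \<times> {..<n} \<times> {..<n}"
  have "X \<in> insert {} (?f ` ?N)" if X: "X \<subseteq> {..<n}" "card X \<le> 3" for X
  proof -
    have fin: "finite X"
      using X finite_subset by blast
    consider "X = {}" | x where "X = {x}" | x y where "X = {x, y}" | x y z where "X = {x, y, z}"
      using X(2) fin
      by (metis One_nat_def Suc_1 card_1_singletonE card_2_iff card_3_iff card_eq_0_iff le_SucE le_zero_eq numeral_3_eq_3)
    then show ?thesis
    proof cases
      case 2
      then show ?thesis using X(1) by (auto intro!: image_eqI[of _ _ "(x, x, x)"])
    next
      case 3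
      then show ?thesis using X(1) by (auto intro!: image_eqI[of _ _ "(x, x, y)"])
    next
      case 4
      then show ?thesis using X(1) by (auto intro!: image_eqI[of _ _ "(x, y, z)"])
    qed simp
  qed
  then have "card {X. X \<subseteq> {..<n} \<and> card X \<le> 3} \<le> card (insert {} (?f ` ?N))"
    by (intro card_mono) auto
  also have "\<dots> \<le> Suc (card (?f ` ?N))"
    by (rule card_insert_le_m1) auto
  also have "card (?f ` ?N) \<le> card ?N"
    by (rule card_image_le) auto
  finally show ?thesis
    by (simp add: power3_eq_cube)
qed

text \<open>
  Only the elements on the three paths witnessing non-rectangularity matter, so the sets may be
  shrunk to at most three elements. This leaves polynomially many triples of a set with its two
  reachable subsets, and repetitions of such triples can be cut out.
\<close>

lemma certificate_complete:
  assumes "derect_seq {..<n} M Ds"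
  obtains k P where "certificate n M k P" "k \<le> (n ^ 3 + 1) ^ 6"
proof -
  define k0 where "k0 = length Ds - 1"
  define D where "D = (!) Ds"
  have len: "length Ds \<ge> 2" and sub: "set Ds \<subseteq> Pow {..<n}" and pur: "purifying M (set Ds)"
    and nonrect: "\<not> rectangular (seq_rel M Ds)"
    using assms unfolding derect_seq_def by auto
  have Ds: "Ds = map D [0..<Suc k0]"
    using len map_nth[of Ds] unfolding D_def k0_def by (metis One_nat_def Suc_1 Suc_le_D diff_Suc_1)
  have k0: "0 < k0"
    using len by (simp add: k0_def)
  have D_in: "D t \<in> set Ds" if "t \<le> k0" for t
    using that len unfolding D_def k0_def by (auto intro: nth_mem)
  obtain i j i' j' where "(i, i') \<in> seq_rel M Ds" "(i, j') \<in> seq_rel M Ds" "(j, i') \<in> seq_rel M Ds"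
    and no: "(j, j') \<notin> seq_rel M Ds"
    using nonrect unfolding rectangular_def by blast
  then obtain p q r where
    p: "p 0 = i" "p k0 = i'" "\<And>t. t < k0 \<Longrightarrow> (p t, p (Suc t)) \<in> star_rel M (D t) (D (Suc t))" and
    q: "q 0 = i" "q k0 = j'" "\<And>t. t < k0 \<Longrightarrow> (q t, q (Suc t)) \<in> star_rel M (D t) (D (Suc t))" and
    r: "r 0 = j" "r k0 = i'" "\<And>t. t < k0 \<Longrightarrow> (r t, r (Suc t)) \<in> star_rel M (D t) (D (Suc t))"
    unfolding Ds seq_rel_upt_path by blast
  define E where "E t = {p t, q t, r t}" for t
  \<comment> \<open>The last point has no outgoing edge and is caught by its incoming one, which
    exists as \<open>0 < k0\<close>.\<close>
  have path_in: "f t \<in> D t"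
    if "t \<le> k0" "\<And>t. t < k0 \<Longrightarrow> (f t, f (Suc t)) \<in> star_rel M (D t) (D (Suc t))" for f t
    using that(1) that(2)[of t] that(2)[of "k0 - 1"] k0
    by (cases "t = k0") (auto simp: star_rel_def)
  have ED: "E t \<subseteq> D t" if "t \<le> k0" for t
    using path_in[OF that p(3)] path_in[OF that q(3)] path_in[OF that r(3)] by (auto simp: E_def)
  have En: "E t \<subseteq> {..<n}" if "t \<le> k0" for t
    using ED[OF that] D_in[OF that] sub by auto
  have E3: "card (E t) \<le> 3" for t
    unfolding E_def by (simp add: card_insert_if)
  define R where "R t = seq_rel M (map E [0..<Suc t])" for t
  have R: "(i, i') \<in> R k0" "(i, j') \<in> R k0" "(j, i') \<in> R k0"
    using p q r unfolding R_def seq_rel_upt_path by (auto simp: E_def star_rel_def)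
  \<comment> \<open>Shrinking the sets keeps the three paths and can only lose pairs, so the fourth
    corner stays missing.\<close>
  have "R k0 \<subseteq> seq_rel M Ds"
  proof (rule subrelI)
    fix x y
    assume "(x, y) \<in> R k0"
    then obtain f where "f 0 = x" "f k0 = y"
      "\<forall>t<k0. (f t, f (Suc t)) \<in> star_rel M (E t) (E (Suc t))"
      unfolding R_def seq_rel_upt_path by blast
    then show "(x, y) \<in> seq_rel M Ds"
      unfolding Ds seq_rel_upt_path using ED
      by (auto simp: star_rel_def intro!: exI[of _ f] subsetD[OF ED])
  qed
  with no have notR: "(j, j') \<notin> R k0"
    by blast

  define adv where "adv A Y = {y \<in> Y. \<exists>x\<in>A. M x y = Star}" for A Y
  have R_sub: "R t `` {x} \<subseteq> E t" if "x \<in> E 0" for x t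
    using that
    by (cases t) (auto simp: R_def seq_rel_upt_0 seq_rel_upt_Suc star_rel_def simp del: upt_Suc)
  have R_Suc: "R (Suc t) `` {x} = adv (R t `` {x}) (E (Suc t))" if "x \<in> E 0" for x t
    using R_sub[OF that, of t] unfolding R_def seq_rel_upt_Suc adv_def star_rel_def by blast
  define F where "F = {X. X \<subseteq> {..<n} \<and> card X \<le> 3}"
  \<comment> \<open>Confining \<open>X\<close> and \<open>Y\<close> to the sets \<open>E t\<close>
    makes every walk in \<open>T\<close> inherit purity from the given sequence. The components
    \<open>A'\<close> and \<open>B'\<close> are determined by the edge, so a shortened walk still
    computes the true images along its own sets.\<close>
  define T where "T = {((X, A, B), (Y, A', B')) | X A B Y A' B'. X \<in> E ` {..k0} \<and> Y \<in> E ` {..k0} \<and>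
    A \<subseteq> X \<and> B \<subseteq> X \<and> A' = adv A Y \<and> B' = adv B Y}"
  define s where "s t = (E t, R t `` {i}, R t `` {j})" for t
  have ij: "i \<in> E 0" "j \<in> E 0"
    using p q r by (auto simp: E_def)
  have "finite F"
    unfolding F_def by simp
  have F_sub: "A \<in> F" if "t \<le> k0" "A \<subseteq> E t" for A t
    unfolding F_def using that En[of t] E3[of t] card_mono[OF _ that(2)]
    by (auto simp: E_def)
  have "adv A Y \<subseteq> Y" for A Y
    by (auto simp: adv_def)
  then have T_sub: "T \<subseteq> (F \<times> F \<times> F) \<times> (F \<times> F \<times> F)"
    unfolding T_def using F_sub by auto
  have "card F \<le> n ^ 3 + 1"
    unfolding F_def by (rule card_small_subsets)
  have "card T \<le> card ((F \<times> F \<times> F) \<times> (F \<times> F \<times> F))"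
    using T_sub \<open>finite F\<close> by (intro card_mono) auto
  also have "\<dots> = card F ^ 6"
    by (simp add: card_cartesian_product eval_nat_numeral)
  also have "\<dots> \<le> (n ^ 3 + 1) ^ 6"
    using \<open>card F \<le> n ^ 3 + 1\<close> by (rule power_mono) simp
  finally have card_T: "card T \<le> (n ^ 3 + 1) ^ 6" .
  have "finite T"
    using T_sub \<open>finite F\<close> by (meson finite_SigmaI finite_subset)
  have "(s t, s (Suc t)) \<in> T" if "t < k0" for t
    using that R_sub[OF ij(1), of t] R_sub[OF ij(2), of t]
    unfolding T_def s_def R_Suc[OF ij(1)] R_Suc[OF ij(2)] by force
  then have "(s 0, s k0) \<in> T ^^ k0"
    unfolding relpow_fun_conv by blast
  then have "(s 0, s k0) \<in> T\<^sup>+"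
    using k0 trancl_power by blast
  \<comment> \<open>The transitive closure, rather than the reflexive one, excludes the empty walk,
    as a certificate needs \<open>0 < k\<close>.\<close>
  then obtain k where k: "0 < k" "k \<le> card T" "(s 0, s k0) \<in> T ^^ k"
    unfolding trancl_finite_eq_relpow[OF \<open>finite T\<close>] by blast
  then obtain f where f: "f 0 = s 0" "f k = s k0" "\<And>t. t < k \<Longrightarrow> (f t, f (Suc t)) \<in> T"
    unfolding relpow_fun_conv by blast
  define P where "P a t x \<longleftrightarrow> (case f t of (X, A, B) \<Rightarrow> x \<in> (if a = 0 then X else if a = 1 then A else B))"
    for a t :: nat and x
  have X_in: "fst (f t) \<in> E ` {..k0}" if "t \<le> k" for t
    using f(1) f(3)[of "t - 1"] that by (cases t) (auto simp: T_def s_def)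
  have pure: "pure_on M (fst (f t)) (fst (f u))" if tu: "t \<le> k" "u \<le> k" for t u
  proof -
    obtain t' u' where "t' \<le> k0" "u' \<le> k0" "fst (f t) = E t'" "fst (f u) = E u'"
      using X_in[OF tu(1)] X_in[OF tu(2)] by auto
    moreover from this have "pure_on M (D t') (D u')"
      using pur D_in unfolding purifying_def by blast
    ultimately show ?thesis
      using ED[of t'] ED[of u'] unfolding pure_on_def by (metis subsetD)
  qed
  have step: "P a (Suc t) y \<longleftrightarrow> P 0 (Suc t) y \<and> (\<exists>x<n. P a t x \<and> M x y = Star)"
    if t: "t < k" and a: "a \<in> {1, 2}" for a t y
  proof -
    obtain X A B Y where "f t = (X, A, B)" "f (Suc t) = (Y, adv A Y, adv B Y)"
      "A \<subseteq> X" "B \<subseteq> X" "X \<in> E ` {..k0}"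
      using f(3)[OF t] unfolding T_def by auto
    moreover from this have "A \<subseteq> {..<n}" "B \<subseteq> {..<n}"
      using En by blast+
    ultimately show ?thesis
      using a unfolding P_def adv_def by auto
  qed
  have init: "\<exists>x<n. P 0 0 x \<and> (\<forall>y<n. P a 0 y \<longleftrightarrow> y = x)" if "a \<in> {1, 2}" for a
  proof -
    have "R 0 = Id"
      unfolding R_def by (rule seq_rel_upt_0)
    moreover have "i < n" "j < n"
      using ij En[of 0] by auto
    ultimately show ?thesis
      using that ij f(1) unfolding P_def s_def by auto
  qed
  have "i' < n" "j' < n"
    using p(2) q(2) En[of k0] by (auto simp: E_def)
  then have final: "\<exists>x<n. P 1 k x \<and> P 2 k x" "\<exists>x<n. P 1 k x \<and> \<not> P 2 k x"
    using R notR f(2) unfolding P_def s_def by auto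
  have pure': "(\<forall>i<n. \<forall>j<n. P 0 t i \<and> P 0 u j \<longrightarrow> M i j \<noteq> Zero) \<or>
      (\<forall>i<n. \<forall>j<n. P 0 t i \<and> P 0 u j \<longrightarrow> M i j \<noteq> One)" if "t \<le> k" "u \<le> k" for t u
    using pure[OF that] unfolding pure_on_def P_def by (auto split: prod.splits)
  have "certificate n M k P"
    unfolding certificate_def by (intro conjI ballI allI impI k(1) pure' init step final)
  then show thesis
    using that k(2) card_T by (meson order_trans)
qed


section \<open>The verifier\<close>

lemma sym_at_pair_less: "z < length x \<Longrightarrow> sym_at (pair x u) z = bit_symbol (x ! z)"
  by (simp add: sym_at_def pair_def nth_append)

text \<open>Positions beyond the certificate read as blank and hence count as unset bits, so
  certificates of any length are meaningful.\<close>

lemma sym_at_pair_cert: "sym_at (pair x u) (length x + 1 + z) = 2 \<longleftrightarrow> z < length u \<and> u ! z"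
  by (auto simp: sym_at_def pair_def nth_append bit_symbol_def)

text \<open>The separator occurs only once, which lets a formula determine the length of the
  instance.\<close>

lemma sym_at_pair_separator: "sym_at (pair x u) z = 3 \<longleftrightarrow> z = length x"
  by (auto simp: sym_at_def pair_def nth_append bit_symbol_def nth_Cons split: nat.split)

lemma bit_symbol_eq_2 [simp]: "bit_symbol b = 2 \<longleftrightarrow> b"
  by (simp add: bit_symbol_def)

lemma length_pair [simp]: "length (pair x u) = length x + 1 + length u"
  by (simp add: pair_def)

lemma set_pair: "set (pair x u) \<subseteq> {1, 2, 3}"
  by (auto simp: pair_def bit_symbol_def)

abbreviation entry_pos :: "nat \<Rightarrow> nat \<Rightarrow> nat \<Rightarrow> nat" where
  "entry_pos n i j \<equiv> i * (2 * n + 2) + 2 * j"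

text \<open>Two set bits also yield \<open>Star\<close> here; \<open>well_coded\<close> forbids them
  inside the matrix and demands them at the row ends.\<close>

definition bits_entry :: "bool \<Rightarrow> bool \<Rightarrow> entry" where
  "bits_entry b c = (if b then Star else if c then One else Zero)"

definition decode :: "(nat \<Rightarrow> bool) \<Rightarrow> nat \<Rightarrow> nat matrix" where
  "decode x n i j = bits_entry (x (entry_pos n i j)) (x (entry_pos n i j + 1))"

definition well_coded :: "(nat \<Rightarrow> bool) \<Rightarrow> nat \<Rightarrow> bool" where
  "well_coded x n \<longleftrightarrow> (\<forall>i<n. x (entry_pos n i n) \<and> x (entry_pos n i n + 1)) \<and>
    (\<forall>i<n. \<forall>j<n. \<not> (x (entry_pos n i j) \<and> x (entry_pos n i j + 1)))"

lemma nth_concat_uniform: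
  assumes "\<And>xs. xs \<in> set xss \<Longrightarrow> length xs = m" "i < length xss" "j < m"
  shows "concat xss ! (i * m + j) = xss ! i ! j"
  using assms
proof (induction xss arbitrary: i)
  case (Cons xs xss)
  show ?case
  proof (cases i)
    case 0
    then show ?thesis using Cons.prems by (simp add: nth_append)
  next
    case (Suc i')
    then show ?thesis using Cons by (simp add: nth_append)
  qed
qed simp

lemma entry_code_eq: "entry_code e = [e = Star, e = One]"
  by (cases e) auto

lemma row_code_nth:
  "j < n \<Longrightarrow> row_code n r ! (2 * j) = (r j = Star)"
  "j < n \<Longrightarrow> row_code n r ! (2 * j + 1) = (r j = One)"
  "row_code n r ! (2 * n)" "row_code n r ! (2 * n + 1)"
proof -
  let ?c = "concat (map (\<lambda>j. entry_code (r j)) [0..<n])"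
  have len: "length ?c = 2 * n"
    by (simp add: length_concat comp_def sum_list_triv)
  have "?c ! (j * 2 + b) = entry_code (r j) ! b" if "j < n" "b < 2" for b
    using that by (subst nth_concat_uniform) auto
  from this[of 0] this[of 1]
  show "j < n \<Longrightarrow> row_code n r ! (2 * j) = (r j = Star)"
    "j < n \<Longrightarrow> row_code n r ! (2 * j + 1) = (r j = One)"
    using len by (simp_all add: row_code_def nth_append entry_code_eq mult.commute)
  show "row_code n r ! (2 * n)" "row_code n r ! (2 * n + 1)"
    using len by (simp_all add: row_code_def nth_append)
qed

text \<open>This turns the nested concatenations into conditions on bits at polynomially computed
  positions, the only kind a formula can express.\<close>

lemma eq_matrix_code_iff:
  "x = matrix_code n M \<longleftrightarrow> length x = n * (2 * n + 2) \<and> well_coded ((!) x) n \<and>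
    (\<forall>i<n. \<forall>j<n. decode ((!) x) n i j = M i j)" (is "_ \<longleftrightarrow> ?R x")
proof
  have nth: "matrix_code n M ! (i * (2 * n + 2) + c) = row_code n (M i) ! c"
    if "i < n" "c < 2 * n + 2" for i c
    unfolding matrix_code_def using that by (subst nth_concat_uniform) auto
  have bits: "matrix_code n M ! (entry_pos n i j) = (M i j = Star)"
    "matrix_code n M ! (entry_pos n i j + 1) = (M i j = One)" if "i < n" "j < n" for i j
    using nth[of i "2 * j"] nth[of i "2 * j + 1"] row_code_nth(1,2)[of j n "M i"] that by simp_all
  have ends: "matrix_code n M ! (entry_pos n i n)" "matrix_code n M ! (entry_pos n i n + 1)"
    if "i < n" for i
    using nth[of i "2 * n"] nth[of i "2 * n + 1"] row_code_nth(3,4)[of n "M i"] that by simp_all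
  have code: "?R (matrix_code n M)"
  proof (intro conjI allI impI)
    show "well_coded ((!) (matrix_code n M)) n"
      unfolding well_coded_def using bits ends by auto
    show "decode ((!) (matrix_code n M)) n i j = M i j" if "i < n" "j < n" for i j
      using bits[OF that] by (cases "M i j") (simp_all add: decode_def bits_entry_def)
  qed (rule length_matrix_code)
  then show "x = matrix_code n M \<Longrightarrow> ?R x"
    by simp
  assume R: "?R x"
  show "x = matrix_code n M"
  proof (rule nth_equalityI)
    fix z
    assume z: "z < length x"
    define i c where "i = z div (2 * n + 2)" and "c = z mod (2 * n + 2)"
    have zi: "z = i * (2 * n + 2) + c" "i < n" "c < 2 * n + 2"
      using z R unfolding i_def c_def
      by (simp_all only: div_mult_mod_eq less_mult_imp_div_less) simp
    \<comment> \<open>Column \<open>j = n\<close> is the row terminator; the smaller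
      \<open>j\<close> are entries, with \<open>b\<close> selecting one of the two bits.\<close>
    obtain j b where c: "c = 2 * j + b" "b = 0 \<or> b = 1"
      by (metis mult_div_mod_eq not_mod_2_eq_1_eq_0)
    have "j \<le> n"
      using c zi by linarith
    then show "x ! z = matrix_code n M ! z"
    proof (cases "j = n")
      case True
      then show ?thesis
        using R code zi(2) c unfolding zi(1) well_coded_def by auto
    next
      case False
      with \<open>j \<le> n\<close> have "j < n"
        by simp
      then have "decode ((!) x) n i j = decode ((!) (matrix_code n M)) n i j"
        "\<not> (x ! entry_pos n i j \<and> x ! (entry_pos n i j + 1))"
        "\<not> (matrix_code n M ! entry_pos n i j \<and> matrix_code n M ! (entry_pos n i j + 1))"
        using R code zi(2) unfolding well_coded_def by metis+
      then show ?thesis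
        using c unfolding zi(1) decode_def bits_entry_def
        by (auto simp: add.assoc split: if_splits)
    qed
  qed (use R length_matrix_code in simp)
qed

text \<open>Each \<open>t\<close> owns three consecutive blocks of \<open>n\<close> bits: the
  characteristic vectors of the set and of its two reachable parts.\<close>

definition cert_pos :: "nat \<Rightarrow> nat \<Rightarrow> nat \<Rightarrow> nat \<Rightarrow> nat" where
  "cert_pos n a t i = (3 * t + a) * n + i"

text \<open>Only the values of \<open>M\<close> below \<open>n\<close> are coded, and certificates
  depend on no others, so the decoded matrix can replace \<open>M\<close>.\<close>

lemma MatrixHasDerectSeq_iff:
  "x \<in> MatrixHasDerectSeq \<longleftrightarrow>
    (\<exists>n. length x = n * (2 * n + 2) \<and> well_coded ((!) x) n \<and>
      (\<forall>i<n. \<forall>j<n. decode ((!) x) n i j = decode ((!) x) n j i) \<and>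
      (\<exists>k\<le>(n ^ 3 + 1) ^ 6. \<exists>P. certificate n (decode ((!) x) n) k P))"
  (is "_ \<longleftrightarrow> (\<exists>n. ?L n \<and> ?W n \<and> ?S n \<and> ?C n)")
proof
  assume "x \<in> MatrixHasDerectSeq"
  then obtain n M Ds where x: "x = matrix_code n M" and sym: "symmetric_on {..<n} M"
    and Ds: "derect_seq {..<n} M Ds"
    unfolding MatrixHasDerectSeq_def by blast
  obtain k P where "certificate n M k P" "k \<le> (n ^ 3 + 1) ^ 6"
    using certificate_complete[OF Ds] .
  moreover have code: "?L n" "?W n" "\<forall>i<n. \<forall>j<n. decode ((!) x) n i j = M i j"
    using x unfolding eq_matrix_code_iff by auto
  moreover from code(3) have "certificate n (decode ((!) x) n) k P \<longleftrightarrow> certificate n M k P"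
    by (intro certificate_cong) auto
  moreover have "?S n"
    using code(3) sym by (auto simp: symmetric_on_def)
  ultimately show "\<exists>n. ?L n \<and> ?W n \<and> ?S n \<and> ?C n"
    by blast
next
  assume "\<exists>n. ?L n \<and> ?W n \<and> ?S n \<and> ?C n"
  then obtain n where n: "?L n" "?W n" "?S n" "?C n"
    by blast
  then have "x = matrix_code n (decode ((!) x) n)"
    unfolding eq_matrix_code_iff by blast
  moreover have "symmetric_on {..<n} (decode ((!) x) n)"
    using n(3) by (simp add: symmetric_on_def)
  moreover have "\<exists>Ds. derect_seq {..<n} (decode ((!) x) n) Ds"
    using n(4) certificate_sound by blast
  ultimately show "x \<in> MatrixHasDerectSeq"
    unfolding MatrixHasDerectSeq_def by blast
qed


subsection \<open>The verifier as a formula\<close>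

definition Or :: "fm \<Rightarrow> fm \<Rightarrow> fm" where
  "Or f g = Neg (And (Neg f) (Neg g))"

definition Iff :: "fm \<Rightarrow> fm \<Rightarrow> fm" where
  "Iff f g = And (Or (Neg f) g) (Or (Neg g) f)"

definition Eq :: "trm \<Rightarrow> trm \<Rightarrow> fm" where
  "Eq t u = And (Neg (Less t u)) (Neg (Less u t))"

definition ExLess :: "nat \<Rightarrow> trm \<Rightarrow> fm \<Rightarrow> fm" where
  "ExLess v b f = Ex v (And (Less (Var v) b) f)"

definition AllLess :: "nat \<Rightarrow> trm \<Rightarrow> fm \<Rightarrow> fm" where
  "AllLess v b f = Neg (ExLess v b (Neg f))"

lemma wf_fm_connectives [simp]:
  "wf_fm d (Or f g) \<longleftrightarrow> wf_fm d f \<and> wf_fm d g"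
  "wf_fm d (Iff f g) \<longleftrightarrow> wf_fm d f \<and> wf_fm d g"
  "wf_fm d (Eq t u) \<longleftrightarrow> wf_trm d t \<and> wf_trm d u"
  by (auto simp: Or_def Iff_def Eq_def)

lemma holds_connectives [simp]:
  "holds w \<sigma> (Or f g) \<longleftrightarrow> holds w \<sigma> f \<or> holds w \<sigma> g"
  "holds w \<sigma> (Iff f g) \<longleftrightarrow> (holds w \<sigma> f \<longleftrightarrow> holds w \<sigma> g)"
  "holds w \<sigma> (Eq t u) \<longleftrightarrow> val \<sigma> t = val \<sigma> u"
  by (auto simp: Or_def Iff_def Eq_def)

lemma wf_fm_ExLess [simp]:
  "wf_fm d (ExLess v b f) \<longleftrightarrow> d \<le> v \<and> wf_trm (Suc v) b \<and> wf_fm (Suc v) f"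
  by (auto simp: ExLess_def)

lemma wf_fm_AllLess [simp]:
  "wf_fm d (AllLess v b f) \<longleftrightarrow> d \<le> v \<and> wf_trm (Suc v) b \<and> wf_fm (Suc v) f"
  by (auto simp: AllLess_def)

text \<open>Since \<open>Ex\<close> includes \<open>length w\<close>, bounds up to
  \<open>length w + 1\<close> are faithful; the bound \<open>k + 1\<close> in \<open>pure_fm\<close>
  makes use of this.\<close>

lemma holds_ExLess [simp]:
  assumes "wf_trm v b" "val \<sigma> b \<le> Suc (length w)"
  shows "holds w \<sigma> (ExLess v b f) \<longleftrightarrow> (\<exists>x<val \<sigma> b. holds w (\<sigma>(v := x)) f)"
proof -
  have "val (\<sigma>(v := x)) b = val \<sigma> b" for x
    by (rule val_cong[OF assms(1)]) simp
  then show ?thesis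
    using assms(2) by (auto simp: ExLess_def) (meson less_Suc_eq_le less_le_trans)
qed

lemma holds_AllLess [simp]:
  assumes "wf_trm v b" "val \<sigma> b \<le> Suc (length w)"
  shows "holds w \<sigma> (AllLess v b f) \<longleftrightarrow> (\<forall>x<val \<sigma> b. holds w (\<sigma>(v := x)) f)"
  by (simp add: AllLess_def assms)

text \<open>
  Variable 0 holds the length of the instance, variable 1 the number \<open>n\<close> of indices, and variable 2
  the index \<open>k\<close> of the last set of the sequence.
\<close>

definition pos_trm :: "nat \<Rightarrow> nat \<Rightarrow> trm" where
  "pos_trm i j =
    Plus (Times (Var i) (Plus (Times (Num 2) (Var 1)) (Num 2))) (Times (Num 2) (Var j))"

definition bit1 :: "nat \<Rightarrow> nat \<Rightarrow> fm" where
  "bit1 i j = At (pos_trm i j) 2"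

definition bit2 :: "nat \<Rightarrow> nat \<Rightarrow> fm" where
  "bit2 i j = At (Plus (pos_trm i j) (Num 1)) 2"

definition mem :: "nat \<Rightarrow> trm \<Rightarrow> nat \<Rightarrow> fm" where
  "mem a t i = At (Plus (Plus (Var 0) (Num 1))
    (Plus (Times (Plus (Times (Num 3) t) (Num a)) (Var 1)) (Var i))) 2"

definition coded_fm :: fm where
  "coded_fm = And (AllLess 3 (Var 1) (And (bit1 3 1) (bit2 3 1)))
    (AllLess 3 (Var 1) (AllLess 4 (Var 1) (Neg (And (bit1 3 4) (bit2 3 4)))))"

text \<open>If the first bits agree and are set, both entries decode to \<open>Star\<close> whatever
  the second bits are; hence the disjunction.\<close>

definition symmetric_fm :: fm where
  "symmetric_fm = AllLess 3 (Var 1) (AllLess 4 (Var 1)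
    (And (Iff (bit1 3 4) (bit1 4 3)) (Or (bit1 3 4) (Iff (bit2 3 4) (bit2 4 3)))))"

definition pure_fm :: fm where
  "pure_fm = AllLess 3 (Plus (Var 2) (Num 1)) (AllLess 4 (Plus (Var 2) (Num 1)) (Or
    (AllLess 5 (Var 1) (AllLess 6 (Var 1)
      (Or (Neg (And (mem 0 (Var 3) 5) (mem 0 (Var 4) 6))) (Or (bit1 5 6) (bit2 5 6)))))
    (AllLess 5 (Var 1) (AllLess 6 (Var 1)
      (Or (Neg (And (mem 0 (Var 3) 5) (mem 0 (Var 4) 6))) (Or (bit1 5 6) (Neg (bit2 5 6))))))))"

definition reach_fm :: "nat \<Rightarrow> fm" where
  "reach_fm a = And
    (ExLess 3 (Var 1) (And (mem 0 (Num 0) 3)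
      (AllLess 4 (Var 1) (Iff (mem a (Num 0) 4) (Eq (Var 4) (Var 3))))))
    (AllLess 3 (Var 2) (AllLess 4 (Var 1) (Iff (mem a (Plus (Var 3) (Num 1)) 4)
      (And (mem 0 (Plus (Var 3) (Num 1)) 4)
        (ExLess 5 (Var 1) (And (mem a (Var 3) 5) (bit1 5 4)))))))"

definition certificate_fm :: fm where
  "certificate_fm = And (Less (Num 0) (Var 2)) (And pure_fm (And (And (reach_fm 1) (reach_fm 2)) (And
    (ExLess 3 (Var 1) (And (mem 1 (Var 2) 3) (mem 2 (Var 2) 3)))
    (ExLess 3 (Var 1) (And (mem 1 (Var 2) 3) (Neg (mem 2 (Var 2) 3)))))))"

definition verifier :: fm where
  "verifier = Ex 0 (And (At (Var 0) 3)
    (Ex 1 (And (Eq (Var 0) (Times (Var 1) (Plus (Times (Num 2) (Var 1)) (Num 2))))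
      (And coded_fm (And symmetric_fm (Ex 2 certificate_fm))))))"

lemma wf_verifier: "wf_fm 0 verifier"
  by (simp add: verifier_def coded_fm_def symmetric_fm_def certificate_fm_def pure_fm_def reach_fm_def
      bit1_def bit2_def mem_def pos_trm_def)

lemma holds_bit1 [simp]: "holds w \<sigma> (bit1 i j) \<longleftrightarrow> sym_at w (entry_pos (\<sigma> 1) (\<sigma> i) (\<sigma> j)) = 2"
  by (simp add: bit1_def pos_trm_def)

lemma holds_bit2 [simp]: "holds w \<sigma> (bit2 i j) \<longleftrightarrow> sym_at w (entry_pos (\<sigma> 1) (\<sigma> i) (\<sigma> j) + 1) = 2"
  by (simp add: bit2_def pos_trm_def)

lemma holds_mem [simp]:
  "holds w \<sigma> (mem a t i) \<longleftrightarrow> sym_at w (\<sigma> 0 + 1 + cert_pos (\<sigma> 1) a (val \<sigma> t) (\<sigma> i)) = 2"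
  by (simp add: mem_def cert_pos_def)

lemma bits_entry_simps:
  "bits_entry b c \<noteq> Zero \<longleftrightarrow> b \<or> c" "bits_entry b c \<noteq> One \<longleftrightarrow> b \<or> \<not> c" "bits_entry b c = Star \<longleftrightarrow> b"
  "bits_entry b c = bits_entry b' c' \<longleftrightarrow> (b \<longleftrightarrow> b') \<and> (b \<or> (c \<longleftrightarrow> c'))"
  by (auto simp: bits_entry_def)

context
  fixes w :: "nat list" and \<sigma> :: "nat \<Rightarrow> nat" and x :: "nat \<Rightarrow> bool"
    and P :: "nat \<Rightarrow> nat \<Rightarrow> nat \<Rightarrow> bool"
  assumes x: "\<And>z. x z \<longleftrightarrow> sym_at w z = 2"
    and P: "\<And>a t i. P a t i \<longleftrightarrow> sym_at w (\<sigma> 0 + 1 + cert_pos (\<sigma> 1) a t i) = 2"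
    and small: "\<sigma> 1 \<le> length w" "\<sigma> 2 \<le> length w"
begin

lemma holds_coded_fm: "holds w \<sigma> coded_fm \<longleftrightarrow> well_coded x (\<sigma> 1)"
  using small by (simp add: coded_fm_def well_coded_def x del: add_Suc_right One_nat_def)

lemma holds_symmetric_fm:
  "holds w \<sigma> symmetric_fm \<longleftrightarrow> (\<forall>i<\<sigma> 1. \<forall>j<\<sigma> 1. decode x (\<sigma> 1) i j = decode x (\<sigma> 1) j i)"
  using small
  by (auto simp: symmetric_fm_def decode_def bits_entry_simps x simp del: add_Suc_right One_nat_def)

lemma holds_certificate_fm:
  "holds w \<sigma> certificate_fm \<longleftrightarrow> certificate (\<sigma> 1) (decode x (\<sigma> 1)) (\<sigma> 2) P"
proof -
  have le: "t < \<sigma> 2 + 1 \<longleftrightarrow> t \<le> \<sigma> 2" for t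
    by auto
  have "holds w \<sigma> pure_fm \<longleftrightarrow> (\<forall>s\<le>\<sigma> 2. \<forall>t\<le>\<sigma> 2.
      (\<forall>i<\<sigma> 1. \<forall>j<\<sigma> 1. P 0 s i \<and> P 0 t j \<longrightarrow> decode x (\<sigma> 1) i j \<noteq> Zero) \<or>
      (\<forall>i<\<sigma> 1. \<forall>j<\<sigma> 1. P 0 s i \<and> P 0 t j \<longrightarrow> decode x (\<sigma> 1) i j \<noteq> One))"
    using small le
    by (simp add: pure_fm_def decode_def bits_entry_simps x P imp_conjL
        del: add_Suc_right One_nat_def)
  moreover have "holds w \<sigma> (reach_fm a) \<longleftrightarrow>
      (\<exists>i<\<sigma> 1. P 0 0 i \<and> (\<forall>j<\<sigma> 1. P a 0 j \<longleftrightarrow> j = i)) \<and>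
      (\<forall>t<\<sigma> 2. \<forall>j<\<sigma> 1. P a (Suc t) j \<longleftrightarrow>
        P 0 (Suc t) j \<and> (\<exists>i<\<sigma> 1. P a t i \<and> decode x (\<sigma> 1) i j = Star))" for a
    using small by (simp add: reach_fm_def decode_def bits_entry_simps x P)
  ultimately show ?thesis
    using small by (simp add: certificate_fm_def certificate_def P conj_assoc)
qed

end


section \<open>Correctness of the verifier on pairs\<close>

lemma holds_verifier:
  "holds w (\<lambda>_. 0) verifier \<longleftrightarrow> (\<exists>X\<le>length w. sym_at w X = 3 \<and> (\<exists>n\<le>length w. X = n * (2 * n + 2) \<and>
    well_coded (\<lambda>z. sym_at w z = 2) n \<and>
    (\<forall>i<n. \<forall>j<n. decode (\<lambda>z. sym_at w z = 2) n i j = decode (\<lambda>z. sym_at w z = 2) n j i) \<and>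
    (\<exists>k\<le>length w. certificate n (decode (\<lambda>z. sym_at w z = 2) n) k
      (\<lambda>a t i. sym_at w (X + 1 + cert_pos n a t i) = 2))))"
proof -
  note fms = holds_coded_fm[OF refl] holds_symmetric_fm[OF refl] holds_certificate_fm[OF refl refl]
  show ?thesis
    unfolding verifier_def by (simp add: fms del: One_nat_def mult_Suc_right cong: conj_cong)
qed

lemma entry_pos_less: "i < n \<Longrightarrow> j \<le> n \<Longrightarrow> entry_pos n i j + 1 < n * (2 * n + 2)"
proof -
  assume "i < n" "j \<le> n"
  then have "entry_pos n i j + 1 < Suc i * (2 * n + 2)"
    by simp
  also have "\<dots> \<le> n * (2 * n + 2)"
    using \<open>i < n\<close> by (intro mult_le_mono1) simp
  finally show ?thesis .
qed

lemma well_coded_cong: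
  assumes "\<And>z. z < n * (2 * n + 2) \<Longrightarrow> x z = y z"
  shows "well_coded x n = well_coded y n"
  unfolding well_coded_def using assms entry_pos_less[of _ n] less_imp_le Suc_lessD
  by (smt (verit) Suc_eq_plus1 le_refl)

lemma decode_cong:
  assumes "\<And>z. z < n * (2 * n + 2) \<Longrightarrow> x z = y z" "i < n" "j < n"
  shows "decode x n i j = decode y n i j"
  using assms(1)[of "entry_pos n i j"] assms(1)[of "entry_pos n i j + 1"] entry_pos_less[of i n j] assms(2,3)
  by (simp add: decode_def)

text \<open>The symbol tests could read past the instance. Under the length equation all positions
  consulted for the matrix lie inside it, and the range of \<open>n\<close> is no restriction; only
  the bound on \<open>k\<close> remains.\<close>

lemma verifier_pair:
  "holds (pair x u) (\<lambda>_. 0) verifier \<longleftrightarrow> (\<exists>n. length x = n * (2 * n + 2) \<and> well_coded ((!) x) n \<and>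
    (\<forall>i<n. \<forall>j<n. decode ((!) x) n i j = decode ((!) x) n j i) \<and>
    (\<exists>k\<le>length (pair x u). certificate n (decode ((!) x) n) k
      (\<lambda>a t i. cert_pos n a t i < length u \<and> u ! cert_pos n a t i)))"
proof -
  let ?b = "\<lambda>z. sym_at (pair x u) z = 2"
  have "well_coded ?b n = well_coded ((!) x) n"
    "(\<forall>i<n. \<forall>j<n. decode ?b n i j = decode ?b n j i) \<longleftrightarrow>
      (\<forall>i<n. \<forall>j<n. decode ((!) x) n i j = decode ((!) x) n j i)"
    "certificate n (decode ?b n) k P = certificate n (decode ((!) x) n) k P"
    "n \<le> length (pair x u)"
    if n: "length x = n * (2 * n + 2)" for n k P
  proof -
    have b: "?b z = x ! z" if "z < n * (2 * n + 2)" for z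
      using that n by (simp add: sym_at_pair_less)
    show "well_coded ?b n = well_coded ((!) x) n"
      using b by (rule well_coded_cong)
    show "(\<forall>i<n. \<forall>j<n. decode ?b n i j = decode ?b n j i) \<longleftrightarrow>
        (\<forall>i<n. \<forall>j<n. decode ((!) x) n i j = decode ((!) x) n j i)"
      using decode_cong[OF b] by simp
    show "certificate n (decode ?b n) k P = certificate n (decode ((!) x) n) k P"
      using decode_cong[OF b] by (intro certificate_cong) auto
    show "n \<le> length (pair x u)"
      using n by simp
  qed
  note * = this
  have ex_eq: "(\<exists>X\<le>N. X = l \<and> Q X) \<longleftrightarrow> l \<le> N \<and> Q l" for N l :: nat and Q
    by blast
  have le: "length x \<le> length (pair x u)"
    by simp
  show ?thesis
    unfolding holds_verifier sym_at_pair_separator ex_eq sym_at_pair_cert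
    by (simp only: le simp_thms, intro ex_cong1) (metis (no_types, lifting) *)
qed

theorem corollary11: "MatrixHasDerectSeq \<in> NP"
proof -
  obtain T q where T: "wf_tm T"
    "\<And>w. set w \<subseteq> {1, 2, 3} \<Longrightarrow> halts_within T w (poly q (length w))"
    "\<And>w. set w \<subseteq> {1, 2, 3} \<Longrightarrow> accepts T w \<longleftrightarrow> holds w (\<lambda>_. 0) verifier"
    using sentence_decidable[OF wf_verifier] by metis
  \<comment> \<open>A certificate has \<open>(3 * k + 3) * n\<close> bits; \<open>k\<close> is
    replaced by its bound and the number of indices by the instance length.\<close>
  have "poly_bounded (\<lambda>n. (3 * (n ^ 3 + 1) ^ 6 + 3) * n)"
    by (intro poly_bounded_intros)
  then obtain p where p: "\<And>n. (3 * (n ^ 3 + 1) ^ 6 + 3) * n \<le> poly p (n::nat)"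
    unfolding poly_bounded_def by blast
  have "x \<in> MatrixHasDerectSeq \<longleftrightarrow> (\<exists>u. length u \<le> poly p (length x) \<and> accepts T (pair x u))" for x
  proof
    assume "x \<in> MatrixHasDerectSeq"
    then obtain n k P where n: "length x = n * (2 * n + 2)" "well_coded ((!) x) n"
      "\<forall>i<n. \<forall>j<n. decode ((!) x) n i j = decode ((!) x) n j i"
      and k: "k \<le> (n ^ 3 + 1) ^ 6" and P: "certificate n (decode ((!) x) n) k P"
      unfolding MatrixHasDerectSeq_iff by blast
    define u where "u = map (\<lambda>z. P (z div n mod 3) (z div n div 3) (z mod n)) [0..<(3 * k + 3) * n]"
    have u: "cert_pos n a t i < length u \<and> u ! cert_pos n a t i \<longleftrightarrow> P a t i"
      if "a < 3" "t \<le> k" "i < n" for a t i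
    proof -
      have "cert_pos n a t i < Suc (3 * t + a) * n"
        using that by (simp add: cert_pos_def)
      also have "\<dots> \<le> (3 * k + 3) * n"
        using that by (intro mult_le_mono1) simp
      finally have "cert_pos n a t i < length u"
        by (simp add: u_def)
      moreover have "cert_pos n a t i div n = 3 * t + a" "cert_pos n a t i mod n = i"
        using that by (simp_all add: cert_pos_def)
      moreover have "(3 * t + a) mod 3 = a" "(3 * t + a) div 3 = t"
        using that by auto
      ultimately show ?thesis
        by (simp add: u_def)
    qed
    have "n \<le> length x"
      using n(1) by simp
    then have "(3 * k + 3) * n \<le> (3 * (length x ^ 3 + 1) ^ 6 + 3) * length x"
      using k by (intro mult_le_mono add_le_mono order_trans[OF k] power_mono) auto
    then have "length u \<le> poly p (length x)"
      using p[of "length x"] by (simp add: u_def)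
    \<comment> \<open>With at least one index, the certificate has at least \<open>k\<close> bits,
      so \<open>k\<close> lies in the range of the quantifier.\<close>
    moreover have "0 < n"
      using P unfolding certificate_def by (auto intro: gr0I)
    then have "k \<le> length (pair x u)"
      by (cases n) (simp_all add: u_def)
    moreover have "certificate n (decode ((!) x) n) k
        (\<lambda>a t i. cert_pos n a t i < length u \<and> u ! cert_pos n a t i)"
      using P by (subst certificate_cong[OF refl u])
    ultimately have "holds (pair x u) (\<lambda>_. 0) verifier"
      unfolding verifier_pair using n by blast
    then show "\<exists>u. length u \<le> poly p (length x) \<and> accepts T (pair x u)"
      using T(3)[OF set_pair] \<open>length u \<le> poly p (length x)\<close> by blast
  next
    assume "\<exists>u. length u \<le> poly p (length x) \<and> accepts T (pair x u)"
    then obtain u where "holds (pair x u) (\<lambda>_. 0) verifier"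
      using T(3)[OF set_pair] by blast
    then obtain n k P where n: "length x = n * (2 * n + 2)" "well_coded ((!) x) n"
      "\<forall>i<n. \<forall>j<n. decode ((!) x) n i j = decode ((!) x) n j i"
      and P: "certificate n (decode ((!) x) n) k P"
      unfolding verifier_pair by blast
    \<comment> \<open>An accepted \<open>k\<close> may exceed the bound when the certificate is
      long. Passing through the sequence it describes produces a short one.\<close>
    obtain k' P' where "certificate n (decode ((!) x) n) k' P'" "k' \<le> (n ^ 3 + 1) ^ 6"
      using certificate_complete[OF certificate_sound[OF P]] .
    then show "x \<in> MatrixHasDerectSeq"
      unfolding MatrixHasDerectSeq_iff using n by blast
  qed
  then show ?thesis
    unfolding NP_def using T(1) T(2)[OF set_pair] by blast
qed

end
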